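(* Let $\mathscr F$ be an admissible space of analytic functions $U\to W$ and fix $z\in U$. If the natural quotient map $\pi_{2,1}:\mathscr X^{(2)}\to \mathscr X^{(1)}$ is strictly singular, then so is $\pi_{n,k}:\mathscr X^{(n)}\to\mathscr X^{(k)}$ for all integers $n>k\ge1$.
   Context: Let $\mathbb D=\{w\in\mathbb C:|w|<1\}$, let $U\subset\mathbb C$ be an open set conformally equivalent to $\mathbb D$, and let $W$ be a complex Banach space. A Banach space $\mathscr F$ of analytic functions $F:U\to W$ is called admissible if: (a) for each $z\in U$ the evaluation map $\delta_z:\mathscr F\to W$, $\delta_z(F)=F(z)$, is bounded; (b) if $\varphi:U\to\mathbb D$ is a conformal equivalence, then an analytic $F:U\to W$ belongs to $\mathscr F$ if and only if $\varphi\cdot F\in\mathscr F$, and in this case $\|\varphi\cdot F\|_{\mathscr F}=\|F\|_{\mathscr F}$. Fix $z\in U$ and write $\widehat f[i;z]=f^{(i)}(z)/i!$. For $n\ge1$, $$\mathscr X^{(n)}=\{(x_{n-1},\dots,x_0)\in W^n:\ \exists f\in\mathscr F,\ x_i=\widehat f[i;z]\text{ for all }0\le i<n\},$$ with norm the infimum of $\|f\|_{\mathscr F}$ over all such $f$; this is a Banach space. For $n>k$, $\pi_{n,k}:\mathscr X^{(n)}\to\mathscr X^{(k)}$ is the projection on the right, $\pi_{n,k}(x_n,\dots,x_k,\dots,x_1)=(x_k,\dots,x_1)$. A bounded operator is strictly singular if its restriction to an infinite-dimensional subspace of its domain is never an isomorphism (onto its image). *)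

theory Defs
  imports
    "HOL-Analysis.Analysis"
    "HOL-Complex_Analysis.Complex_Analysis"
    "HOL-Library.Function_Algebras"
begin

class complex_vector = ab_group_add +
  fixes scaleC :: "complex \<Rightarrow> 'a \<Rightarrow> 'a"  (infixr \<open>*\<^sub>C\<close> 75)
  assumes scaleC_add_right: "a *\<^sub>C (x + y) = a *\<^sub>C x + a *\<^sub>C y"
    and scaleC_add_left: "(a + b) *\<^sub>C x = a *\<^sub>C x + b *\<^sub>C x"
    and scaleC_scaleC: "a *\<^sub>C (b *\<^sub>C x) = (a * b) *\<^sub>C x"
    and scaleC_one: "1 *\<^sub>C x = x"

global_interpretation complex_vector:
  vector_space "scaleC :: complex \<Rightarrow> 'a \<Rightarrow> 'a::complex_vector"
  defines csubspace = complex_vector.subspace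
    and cspan = complex_vector.span
  by unfold_locales (simp_all add: scaleC_add_right scaleC_add_left scaleC_scaleC scaleC_one)

class complex_banach = complex_vector + banach +
  assumes scaleR_eq_scaleC: "r *\<^sub>R x = complex_of_real r *\<^sub>C x"
    and norm_scaleC: "norm (a *\<^sub>C x) = cmod a * norm x"

instantiation "fun" :: (type, complex_vector) complex_vector
begin

definition scaleC_fun :: "complex \<Rightarrow> ('a \<Rightarrow> 'b) \<Rightarrow> 'a \<Rightarrow> 'b"
  where "scaleC_fun a f = (\<lambda>x. a *\<^sub>C f x)"

instance
  by standard
    (simp_all add: scaleC_fun_def fun_eq_iff scaleC_add_right scaleC_add_left
      scaleC_scaleC scaleC_one)

end

text \<open>
  Function spaces and their quotients are handled as pairs of a carrier \<open>V\<close>, a complex linear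
  subspace of an ambient vector space type, and a norm \<open>N\<close> that is meaningful on \<open>V\<close> only.
\<close>

locale complex_banach_space_on =
  fixes V :: "'v::complex_vector set" and N :: "'v \<Rightarrow> real"
  assumes subspace: "csubspace V"
    and norm_ge_zero: "x \<in> V \<Longrightarrow> 0 \<le> N x"
    and norm_eq_zero: "x \<in> V \<Longrightarrow> N x = 0 \<longleftrightarrow> x = 0"
    and norm_triangle: "x \<in> V \<Longrightarrow> y \<in> V \<Longrightarrow> N (x + y) \<le> N x + N y"
    and norm_scale: "x \<in> V \<Longrightarrow> N (a *\<^sub>C x) = cmod a * N x"
    and complete:
      "(\<And>i. \<sigma> i \<in> V) \<Longrightarrow>
        (\<And>e. e > 0 \<Longrightarrow> \<exists>M. \<forall>i\<ge>M. \<forall>j\<ge>M. N (\<sigma> i - \<sigma> j) < e) \<Longrightarrow>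
        \<exists>x\<in>V. (\<lambda>i. N (\<sigma> i - x)) \<longlonglongrightarrow> 0"

definition bounded_operator_on ::
  "'v::complex_vector set \<Rightarrow> ('v \<Rightarrow> real) \<Rightarrow> 'u::complex_vector set \<Rightarrow> ('u \<Rightarrow> real) \<Rightarrow>
    ('v \<Rightarrow> 'u) \<Rightarrow> bool"
  where "bounded_operator_on V N V' N' T \<longleftrightarrow>
    T ` V \<subseteq> V' \<and>
    (\<forall>x\<in>V. \<forall>y\<in>V. T (x + y) = T x + T y) \<and>
    (\<forall>a. \<forall>x\<in>V. T (a *\<^sub>C x) = a *\<^sub>C T x) \<and>
    (\<exists>C. \<forall>x\<in>V. N' (T x) \<le> C * N x)"

definition isomorphism_onto_image ::
  "'v::complex_vector set \<Rightarrow> ('v \<Rightarrow> real) \<Rightarrow> ('u::complex_vector \<Rightarrow> real) \<Rightarrow> ('v \<Rightarrow> 'u) \<Rightarrow> bool"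
  where "isomorphism_onto_image E N N' T \<longleftrightarrow>
    bounded_operator_on E N (T ` E) N' T \<and>
    inj_on T E \<and>
    bounded_operator_on (T ` E) N' E N (inv_into E T)"

definition infinite_dimensional :: "'v::complex_vector set \<Rightarrow> bool"
  where "infinite_dimensional E \<longleftrightarrow> \<not> (\<exists>B. finite B \<and> E = cspan B)"

text \<open>Subspaces are linear subspaces, not assumed to be closed.\<close>

definition strictly_singular ::
  "'v::complex_vector set \<Rightarrow> ('v \<Rightarrow> real) \<Rightarrow> 'u::complex_vector set \<Rightarrow> ('u \<Rightarrow> real) \<Rightarrow>
    ('v \<Rightarrow> 'u) \<Rightarrow> bool"
  where "strictly_singular V N V' N' T \<longleftrightarrow>
    bounded_operator_on V N V' N' T \<and>
    (\<forall>E. csubspace E \<and> E \<subseteq> V \<and> infinite_dimensional E \<longrightarrow>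
      \<not> isomorphism_onto_image E N N' T)"

definition conformal_equivalence :: "(complex \<Rightarrow> complex) \<Rightarrow> complex set \<Rightarrow> complex set \<Rightarrow> bool"
  where "conformal_equivalence \<phi> U V \<longleftrightarrow>
    bij_betw \<phi> U V \<and> \<phi> holomorphic_on U \<and> inv_into U \<phi> holomorphic_on V"

text \<open>
  A function \<open>U \<Rightarrow> W\<close> is represented by its extension by \<open>0\<close> to the whole plane, so that functions
  on \<open>U\<close> form a linear subspace of \<open>complex \<Rightarrow> 'w\<close>. Analytic means locally given by a convergent
  power series.
\<close>

definition analytic_function :: "complex set \<Rightarrow> (complex \<Rightarrow> 'w::complex_banach) \<Rightarrow> bool"
  where "analytic_function U f \<longleftrightarrow>
    (\<forall>w. w \<notin> U \<longrightarrow> f w = 0) \<and>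
    (\<forall>z\<in>U. \<exists>r>0. \<exists>a. ball z r \<subseteq> U \<and>
      (\<forall>w\<in>ball z r. (\<lambda>n. (w - z) ^ n *\<^sub>C a n) sums f w))"

definition vderiv :: "(complex \<Rightarrow> 'w::complex_banach) \<Rightarrow> complex \<Rightarrow> 'w"
  where "vderiv f z = (SOME D. (f has_derivative (\<lambda>h. h *\<^sub>C D)) (at z))"

definition taylor_coeff :: "(complex \<Rightarrow> 'w::complex_banach) \<Rightarrow> nat \<Rightarrow> complex \<Rightarrow> 'w"
  where "taylor_coeff f i z = (1 / fact i) *\<^sub>C (vderiv ^^ i) f z"

locale admissible_space = complex_banach_space_on F N
  for U :: "complex set"
    and F :: "(complex \<Rightarrow> 'w::complex_banach) set"
    and N :: "(complex \<Rightarrow> 'w) \<Rightarrow> real" +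
  assumes analytic: "f \<in> F \<Longrightarrow> analytic_function U f"
    and evaluation_bounded: "z \<in> U \<Longrightarrow> \<exists>C. \<forall>f\<in>F. norm (f z) \<le> C * N f"
    and mult_conformal_iff:
      "conformal_equivalence \<phi> U (ball 0 1) \<Longrightarrow> analytic_function U f \<Longrightarrow>
        f \<in> F \<longleftrightarrow> (\<lambda>w. \<phi> w *\<^sub>C f w) \<in> F"
    and norm_mult_conformal:
      "conformal_equivalence \<phi> U (ball 0 1) \<Longrightarrow> f \<in> F \<Longrightarrow> N (\<lambda>w. \<phi> w *\<^sub>C f w) = N f"

text \<open>
  An \<open>n\<close>-tuple \<open>(x\<^sub>n\<^sub>-\<^sub>1, \<dots>, x\<^sub>0)\<close> is represented by a function on \<open>nat\<close> that vanishes at all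
  indices \<open>i \<ge> n\<close>. Keeping the \<open>k\<close> rightmost entries of a tuple means keeping the indices \<open>i < k\<close>.
\<close>

definition jet_space ::
  "(complex \<Rightarrow> 'w::complex_banach) set \<Rightarrow> complex \<Rightarrow> nat \<Rightarrow> (nat \<Rightarrow> 'w) set"
  where "jet_space F z n =
    {x. (\<forall>i\<ge>n. x i = 0) \<and> (\<exists>f\<in>F. \<forall>i<n. x i = taylor_coeff f i z)}"

definition jet_norm ::
  "(complex \<Rightarrow> 'w::complex_banach) set \<Rightarrow> ((complex \<Rightarrow> 'w) \<Rightarrow> real) \<Rightarrow> complex \<Rightarrow> nat \<Rightarrow>
    (nat \<Rightarrow> 'w) \<Rightarrow> real"
  where "jet_norm F N z n x = (INF f\<in>{f\<in>F. \<forall>i<n. x i = taylor_coeff f i z}. N f)"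

definition jet_proj :: "nat \<Rightarrow> (nat \<Rightarrow> 'w::zero) \<Rightarrow> nat \<Rightarrow> 'w"
  where "jet_proj k x = (\<lambda>i. if i < k then x i else 0)"

end

theory Submission
  imports Defs
begin

text \<open>
  Let \<open>\<phi>\<close> be a conformal map of \<open>U\<close> onto the disc with \<open>\<phi> z = 0\<close>. A function in \<open>F\<close> vanishes to
  order \<open>n\<close> at \<open>z\<close> exactly if it is \<open>\<phi> ^ n\<close> times a function in \<open>F\<close>. So the space of \<open>n\<close>-jets is
  the quotient of \<open>F\<close> by \<open>\<phi> ^ n F\<close>, and its norm is induced by the seminorm
  \<open>q n f = inf {N (f - \<phi> ^ n g) | g \<in> F}\<close> on \<open>F\<close>. Since multiplication by \<open>\<phi>\<close> is
  isometric, \<open>q (n + 1) (\<phi> f) = q n f\<close>: multiplication by \<open>\<phi>\<close> embeds the \<open>n\<close>-jets isometrically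
  into the \<open>(n + 1)\<close>-jets, as the kernel of the projection to \<open>1\<close>-jets.

  The projection from \<open>n\<close>-jets to \<open>k\<close>-jets factors through the \<open>(k + 1)\<close>-jets, so it suffices to
  treat \<open>n = k + 1\<close>, by induction on \<open>k\<close>. Suppose that the projection from \<open>(k + 2)\<close>-jets to
  \<open>(k + 1)\<close>-jets were an isomorphism on an infinite-dimensional subspace \<open>E\<close>. The projection to
  \<open>1\<close>-jets factors through the \<open>2\<close>-jets, so it is strictly singular. Hence \<open>E\<close> contains a
  sequence of unit vectors, independent in a quantitative sense, whose \<open>1\<close>-jets are
  extremely small. A small perturbation moves the whole sequence into the kernel of
  the projection to \<open>1\<close>-jets, and the projection to \<open>(k + 1)\<close>-jets remains an isomorphism on the
  span of the perturbed sequence. Under the isometries above this says that the projection from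
  \<open>(k + 1)\<close>-jets to \<open>k\<close>-jets is not strictly singular, contrary to the induction hypothesis.

  The perturbation argument is \<open>strictly_finer_three_space\<close>. It is phrased for three seminorms on
  one vector space, with \<open>strictly_finer\<close> standing for strict singularity of the canonical map
  between the associated quotients; \<open>strictly_singular_iff_strictly_finer\<close> translates between the
  two languages. The independence comes from norming functionals, hence from the Hahn-Banach
  theorem, proved here through minimal sublinear functionals. The remaining part is the calculus of
  power series with coefficients in a Banach space, which identifies Taylor coefficients and shows
  that a function vanishing to order \<open>n\<close> is divisible by \<open>\<phi> ^ n\<close>
  (\<open>centred_admissible_space.vanishing_iff_mult_power\<close>).
\<close>

section \<open>Norming functionals for a seminorm\<close>

definition sublinear :: "('v::complex_vector \<Rightarrow> real) \<Rightarrow> bool"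
  where "sublinear u \<longleftrightarrow>
    (\<forall>x y. u (x + y) \<le> u x + u y) \<and> (\<forall>t\<ge>0. \<forall>x. u (complex_of_real t *\<^sub>C x) \<le> t * u x)"

lemma sublinearD:
  assumes "sublinear u"
  shows "u (x + y) \<le> u x + u y" "t \<ge> 0 \<Longrightarrow> u (complex_of_real t *\<^sub>C x) \<le> t * u x"
  using assms by (auto simp: sublinear_def)

lemma sublinear_zero: assumes "sublinear u" shows "u 0 = 0"
  using sublinearD(2)[OF assms, of 0 0] sublinearD(1)[OF assms, of 0 0] by simp

lemma sublinear_scale:
  assumes u: "sublinear u" and "t \<ge> 0"
  shows "u (complex_of_real t *\<^sub>C x) = t * u x"
proof (cases "t = 0")
  case False
  with \<open>t \<ge> 0\<close> have t: "t > 0" by simp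
  have "complex_of_real (1 / t) *\<^sub>C complex_of_real t *\<^sub>C x = x"
    using t by (simp add: scaleC_scaleC scaleC_one)
  then have "u x \<le> (1 / t) * u (complex_of_real t *\<^sub>C x)"
    using sublinearD(2)[OF u, of "1 / t" "complex_of_real t *\<^sub>C x"] t by simp
  then show ?thesis
    using t sublinearD(2)[OF u \<open>t \<ge> 0\<close>, of x] by (simp add: field_simps)
qed (use sublinear_zero[OF u] in simp)

lemma sublinear_ge_neg:
  assumes "sublinear u" shows "- u (- x) \<le> u x"
  using sublinearD(1)[OF assms, of x "- x"] sublinear_zero[OF assms] by simp

text \<open>
  The largest sublinear functional below \<open>u\<close> whose value at \<open>- y\<close> is at most \<open>- u y\<close>. It serves
  twice: it forces a minimal sublinear functional to be odd, hence linear, and it makes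
  the functional found below a seminorm attain that seminorm at a prescribed vector.
\<close>

definition tilt :: "('v::complex_vector \<Rightarrow> real) \<Rightarrow> 'v \<Rightarrow> 'v \<Rightarrow> real"
  where "tilt u y x = (INF t\<in>{0..}. u (x + complex_of_real t *\<^sub>C y) - t * u y)"

context
  fixes u :: "'v::complex_vector \<Rightarrow> real"
  assumes u: "sublinear u"
begin

lemma tilt_ge: "t \<ge> 0 \<Longrightarrow> - u (- x) \<le> u (x + complex_of_real t *\<^sub>C y) - t * u y"
  using sublinearD(1)[OF u, of "x + complex_of_real t *\<^sub>C y" "- x"] sublinear_scale[OF u, of t y]
  by simp

lemma tilt_le: "t \<ge> 0 \<Longrightarrow> tilt u y x \<le> u (x + complex_of_real t *\<^sub>C y) - t * u y"
  unfolding tilt_def by (rule cINF_lower) (auto intro!: bdd_belowI2[of _ "- u (- x)"] tilt_ge)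

lemma tilt_greatest:
  "(\<And>t. t \<ge> 0 \<Longrightarrow> c \<le> u (x + complex_of_real t *\<^sub>C y) - t * u y) \<Longrightarrow> c \<le> tilt u y x"
  unfolding tilt_def by (rule cINF_greatest) auto

lemma tilt_le_self: "tilt u y x \<le> u x"
  using tilt_le[of 0 y x] by simp

lemma tilt_neg: "tilt u y (- y) \<le> - u y"
  using tilt_le[of 1 y "- y"] sublinear_zero[OF u] by (simp add: scaleC_one)

lemma sublinear_tilt: "sublinear (tilt u y)"
  unfolding sublinear_def
proof (intro conjI allI impI)
  fix x x'
  have "tilt u y (x + x') - (u (x + complex_of_real t *\<^sub>C y) - t * u y) \<le> tilt u y x'"
    if "t \<ge> 0" for t
  proof (rule tilt_greatest)
    fix s :: real assume "s \<ge> 0"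
    have "tilt u y (x + x') \<le> u (x + x' + complex_of_real (t + s) *\<^sub>C y) - (t + s) * u y"
      using that \<open>s \<ge> 0\<close> by (intro tilt_le) simp
    also have "x + x' + complex_of_real (t + s) *\<^sub>C y
        = (x + complex_of_real t *\<^sub>C y) + (x' + complex_of_real s *\<^sub>C y)"
      by (simp add: scaleC_add_left)
    finally show "tilt u y (x + x') - (u (x + complex_of_real t *\<^sub>C y) - t * u y)
        \<le> u (x' + complex_of_real s *\<^sub>C y) - s * u y"
      using sublinearD(1)[OF u, of "x + complex_of_real t *\<^sub>C y" "x' + complex_of_real s *\<^sub>C y"]
      by (simp add: algebra_simps)
  qed
  then have "tilt u y (x + x') - tilt u y x' \<le> tilt u y x"
    by (intro tilt_greatest) (simp add: algebra_simps)
  then show "tilt u y (x + x') \<le> tilt u y x + tilt u y x'" by simp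
next
  fix s :: real and x assume "s \<ge> 0"
  show "tilt u y (complex_of_real s *\<^sub>C x) \<le> s * tilt u y x"
  proof (cases "s = 0")
    case True
    then show ?thesis using tilt_le_self[of y 0] sublinear_zero[OF u] by simp
  next
    case False
    with \<open>s \<ge> 0\<close> have s: "s > 0" by simp
    have "tilt u y (complex_of_real s *\<^sub>C x) / s \<le> tilt u y x"
    proof (rule tilt_greatest)
      fix t :: real assume t: "t \<ge> 0"
      have "tilt u y (complex_of_real s *\<^sub>C x)
          \<le> u (complex_of_real s *\<^sub>C x + complex_of_real (s * t) *\<^sub>C y) - (s * t) * u y"
        using s t by (intro tilt_le) simp
      also have "complex_of_real s *\<^sub>C x + complex_of_real (s * t) *\<^sub>C y
          = complex_of_real s *\<^sub>C (x + complex_of_real t *\<^sub>C y)"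
        by (simp add: scaleC_add_right scaleC_scaleC)
      finally show "tilt u y (complex_of_real s *\<^sub>C x) / s
          \<le> u (x + complex_of_real t *\<^sub>C y) - t * u y"
        using sublinear_scale[OF u, of s "x + complex_of_real t *\<^sub>C y"] s
        by (simp add: field_simps)
    qed
    then show ?thesis using s by (simp add: field_simps)
  qed
qed

end

text \<open>
  Zorn's lemma applies because the members of a chain are uniformly bounded below:
  \<open>u x \<ge> - u (- x) \<ge> - p (- x)\<close>, so that the pointwise infimum exists.
\<close>

lemma exists_minimal_sublinear:
  assumes p: "sublinear p"
  shows "\<exists>u. sublinear u \<and> u \<le> p \<and> (\<forall>v. sublinear v \<and> v \<le> u \<longrightarrow> v = u)"
proof -
  define A where "A = {u. sublinear u \<and> u \<le> p}"
  have "\<exists>m\<in>A. \<forall>a\<in>A. a \<le> m \<longrightarrow> a = m"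
  proof (rule predicate_Zorn)
    show "partial_order_on A (relation_of (\<lambda>u v. v \<le> u) A)"
      by (auto simp: partial_order_on_def preorder_on_def refl_on_def trans_def antisym_def
          relation_of_def)
    fix C assume C: "C \<in> Chains (relation_of (\<lambda>u v. v \<le> u) A)"
    then have CA: "C \<subseteq> A" and tot: "\<And>a b. a \<in> C \<Longrightarrow> b \<in> C \<Longrightarrow> a \<le> b \<or> b \<le> a"
      by (auto simp: Chains_def relation_of_def)
    show "\<exists>m\<in>A. \<forall>a\<in>C. m \<le> a"
    proof (cases "C = {}")
      case True
      then show ?thesis using p by (auto simp: A_def)
    next
      case False
      define m where "m x = (INF u\<in>C. u x)" for x
      have bdd: "bdd_below ((\<lambda>u. u x) ` C)" for x
      proof (rule bdd_belowI2)
        fix u assume "u \<in> C"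
        then have "sublinear u" "u (- x) \<le> p (- x)" using CA by (auto simp: A_def le_fun_def)
        then show "- p (- x) \<le> u x" using sublinear_ge_neg[of u x] by simp
      qed
      have m_le: "m x \<le> u x" if "u \<in> C" for u x
        unfolding m_def using bdd that by (rule cINF_lower)
      have m_ge: "c \<le> m x" if "\<And>u. u \<in> C \<Longrightarrow> c \<le> u x" for c x
        unfolding m_def using False that by (rule cINF_greatest)
      have "sublinear m"
        unfolding sublinear_def
      proof (intro conjI allI impI)
        fix x y
        have "m (x + y) \<le> u x + v y" if uv: "u \<in> C" "v \<in> C" for u v
        proof -
          \<comment> \<open>The smaller of the two members of the chain serves both summands.\<close>
          obtain w where w: "w \<in> C" "w \<le> u" "w \<le> v" using tot[OF uv] uv by auto
          then have "m (x + y) \<le> w x + w y"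
            using m_le[of w "x + y"] sublinearD(1)[of w x y] CA by (auto simp: A_def)
          also have "\<dots> \<le> u x + v y" using w by (intro add_mono) (auto simp: le_fun_def)
          finally show ?thesis .
        qed
        then have "m (x + y) - v y \<le> m x" if "v \<in> C" for v
          using that by (intro m_ge) (auto simp: algebra_simps)
        then have "m (x + y) - m x \<le> m y"
          by (intro m_ge) (auto simp: algebra_simps)
        then show "m (x + y) \<le> m x + m y" by simp
      next
        fix t :: real and x assume t: "t \<ge> 0"
        have eq: "m (complex_of_real t *\<^sub>C x) \<le> t * u x" if "u \<in> C" for u
          using m_le[OF that, of "complex_of_real t *\<^sub>C x"] sublinearD(2)[OF _ t, of u x] CA that
          by (auto simp: A_def)
        show "m (complex_of_real t *\<^sub>C x) \<le> t * m x"
        proof (cases "t = 0")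
          case True
          then show ?thesis using eq False by auto
        next
          case False
          then have "t > 0" using t by simp
          have "m (complex_of_real t *\<^sub>C x) / t \<le> m x"
            by (rule m_ge) (use eq \<open>t > 0\<close> in \<open>simp add: field_simps\<close>)
          then show ?thesis using \<open>t > 0\<close> by (simp add: field_simps)
        qed
      qed
      moreover have "m \<le> p"
      proof -
        obtain u where "u \<in> C" using False by auto
        then have "m x \<le> p x" for x
          using m_le[of u x] CA by (auto simp: A_def le_fun_def intro: order_trans)
        then show ?thesis by (simp add: le_fun_def)
      qed
      ultimately show ?thesis using m_le by (auto simp: A_def le_fun_def)
    qed
  qed
  then show ?thesis unfolding A_def by (auto intro: order_trans)
qed

text \<open>
  Tilting along \<open>x\<close> cannot decrease a minimal \<open>u\<close>, so \<open>u (- x) \<le> - u x\<close>. An odd sublinear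
  functional is additive, since subadditivity for \<open>- x\<close> and \<open>- y\<close> is superadditivity for \<open>x\<close> and
  \<open>y\<close>.
\<close>

lemma minimal_sublinear_linear:
  assumes u: "sublinear u" and min: "\<And>v. sublinear v \<Longrightarrow> v \<le> u \<Longrightarrow> v = u"
  shows "u (x + y) = u x + u y" "u (complex_of_real t *\<^sub>C x) = t * u x"
proof -
  have neg: "u (- x) = - u x" for x
  proof -
    have "tilt u x = u"
      using sublinear_tilt[OF u] tilt_le_self[OF u] by (intro min) (auto simp: le_fun_def)
    then show ?thesis using tilt_neg[OF u, of x] sublinear_ge_neg[OF u, of x] by simp
  qed
  show "u (x + y) = u x + u y"
    using sublinearD(1)[OF u, of x y] sublinearD(1)[OF u, of "- x" "- y"] neg[of "x + y"]
      neg[of x] neg[of y] by simp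
  show "u (complex_of_real t *\<^sub>C x) = t * u x"
  proof (cases "t \<ge> 0")
    case False
    then show ?thesis
      using sublinear_scale[OF u, of "- t" x] neg[of "complex_of_real t *\<^sub>C x"] by simp
  qed (use sublinear_scale[OF u] in simp)
qed

definition seminorm_on :: "'v::complex_vector set \<Rightarrow> ('v \<Rightarrow> real) \<Rightarrow> bool"
  where "seminorm_on V p \<longleftrightarrow> csubspace V \<and>
    (\<forall>x\<in>V. \<forall>y\<in>V. p (x + y) \<le> p x + p y) \<and> (\<forall>a. \<forall>x\<in>V. p (a *\<^sub>C x) = cmod a * p x)"

text \<open>
  The complex functional is recovered from its real part \<open>u\<close> as \<open>u x - \<i> u (\<i> x)\<close>. Choosing \<open>u\<close>
  minimal below the seminorm tilted along \<open>x0\<close>, instead of below the seminorm itself, makes the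
  functional norming at \<open>x0\<close>.
\<close>

lemma exists_norming_functional_UNIV:
  fixes p :: "'v::complex_vector \<Rightarrow> real"
  assumes p: "seminorm_on UNIV p"
  shows "\<exists>g. (\<forall>x y. g (x + y) = g x + g y) \<and> (\<forall>a x. g (a *\<^sub>C x) = a * g x) \<and>
    (\<forall>x. cmod (g x) \<le> p x) \<and> g x0 = complex_of_real (p x0)"
proof -
  have sub: "sublinear p" using p by (auto simp: seminorm_on_def sublinear_def)
  have scale: "p (a *\<^sub>C x) = cmod a * p x" for a x using p by (auto simp: seminorm_on_def)
  obtain u where u: "sublinear u" "u \<le> tilt p x0"
      and min: "\<And>v. sublinear v \<Longrightarrow> v \<le> u \<Longrightarrow> v = u"
    using exists_minimal_sublinear[OF sublinear_tilt[OF sub]] by metis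
  note lin = minimal_sublinear_linear[OF u(1) min]
  have le: "u x \<le> p x" for x
    using u(2) tilt_le_self[OF sub] by (auto simp: le_fun_def intro: order_trans)
  define g where "g x = Complex (u x) (- u (\<i> *\<^sub>C x))" for x
  have add: "g (x + y) = g x + g y" for x y
    by (simp add: g_def lin scaleC_add_right complex_eq_iff)
  have mul: "g (a *\<^sub>C x) = a * g x" for a x
  proof -
    have a: "a *\<^sub>C x = complex_of_real (Re a) *\<^sub>C x + complex_of_real (Im a) *\<^sub>C \<i> *\<^sub>C x"
      unfolding scaleC_scaleC scaleC_add_left[symmetric]
      by (simp add: complex_eq[symmetric] mult.commute)
    have b: "\<i> *\<^sub>C a *\<^sub>C x
        = complex_of_real (Re a) *\<^sub>C \<i> *\<^sub>C x + complex_of_real (- Im a) *\<^sub>C x"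
      unfolding scaleC_scaleC scaleC_add_left[symmetric]
      by (rule arg_cong[of _ _ "\<lambda>c. c *\<^sub>C x"]) (simp add: complex_eq_iff)
    have "u (a *\<^sub>C x) = Re a * u x + Im a * u (\<i> *\<^sub>C x)"
      by (subst a) (simp only: lin)
    moreover have "u (\<i> *\<^sub>C a *\<^sub>C x) = Re a * u (\<i> *\<^sub>C x) - Im a * u x"
      by (subst b) (simp only: lin)
    ultimately show ?thesis
      by (simp add: g_def complex_eq_iff)
  qed
  have bound: "cmod (g x) \<le> p x" for x
  proof -
    \<comment> \<open>Rotate \<open>x\<close> so that the value of \<open>g\<close> becomes real; then \<open>u\<close> alone computes it.\<close>
    obtain c where c: "cmod c = 1" "c * g x = complex_of_real (cmod (g x))"
    proof (cases "g x = 0")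
      case True
      then show ?thesis using that[of 1] by simp
    next
      case False
      then show ?thesis
        using that[of "cnj (g x) / complex_of_real (cmod (g x))"] complex_norm_square[of "g x"]
        by (simp add: norm_divide power2_eq_square field_simps)
    qed
    have "cmod (g x) = Re (g (c *\<^sub>C x))" by (simp add: mul c)
    also have "\<dots> \<le> p (c *\<^sub>C x)" using le by (simp add: g_def)
    finally show ?thesis by (simp add: scale c)
  qed
  have "u (- x0) = - u x0" using lin(2)[of "-1" x0] by (simp add: scaleC_one)
  moreover have "u (- x0) \<le> - p x0"
    using u(2) tilt_neg[OF sub, of x0] by (auto simp: le_fun_def intro: order_trans)
  ultimately have "Re (g x0) = p x0" using le[of x0] by (simp add: g_def)
  moreover have "Im (g x0) = 0"
  proof -
    have "(Re (g x0))\<^sup>2 + (Im (g x0))\<^sup>2 \<le> (p x0)\<^sup>2"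
      using power_mono[OF bound[of x0] norm_ge_zero, of 2] by (simp add: cmod_power2)
    then show ?thesis using \<open>Re (g x0) = p x0\<close> by simp
  qed
  ultimately have "g x0 = complex_of_real (p x0)" by (simp add: complex_eq_iff)
  then show ?thesis using add mul bound by blast
qed

text \<open>
  A linear projection of the ambient space onto \<open>V\<close> extends the seminorm to the ambient space.
\<close>

lemma exists_norming_functional:
  fixes V :: "'v::complex_vector set"
  assumes p: "seminorm_on V p" and x0: "x0 \<in> V"
  shows "\<exists>g. (\<forall>x y. g (x + y) = g x + g y) \<and> (\<forall>a x. g (a *\<^sub>C x) = a * g x) \<and>
    (\<forall>x\<in>V. cmod (g x) \<le> p x) \<and> g x0 = complex_of_real (p x0)"
proof -
  interpret vector_space_pair "scaleC :: complex \<Rightarrow> 'v \<Rightarrow> 'v" "scaleC :: complex \<Rightarrow> 'v \<Rightarrow> 'v" ..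
  have V: "csubspace V" using p by (simp add: seminorm_on_def)
  have "Vector_Spaces.linear scaleC scaleC (\<lambda>x::'v. x)"
    by (rule complex_vector.linear_ident)
  then obtain P :: "'v \<Rightarrow> 'v" where P: "range P \<subseteq> V" "Vector_Spaces.linear scaleC scaleC P"
      and id: "\<And>v. v \<in> V \<Longrightarrow> P v = v"
    using linear_exists_left_inverse_on[OF _ V[unfolded csubspace_def], of "\<lambda>x. x"] by auto
  have "P (x + y) = P x + P y" "P (a *\<^sub>C x) = a *\<^sub>C P x" for x y a
    using P(2) by (auto simp: linear_add linear_scale)
  moreover have "P x \<in> V" for x using P(1) by auto
  ultimately have "seminorm_on UNIV (p \<circ> P)"
    using p by (auto simp: seminorm_on_def)
  from exists_norming_functional_UNIV[OF this, of x0] show ?thesis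
    using id x0 by (auto; metis)
qed

section \<open>Domination of seminorms on infinite-dimensional subspaces\<close>

text \<open>
  The representatives of the image of \<open>E\<close> in the quotient by the kernel of \<open>p\<close> are taken in
  \<open>E\<close> itself, so that inequalities between seminorms on \<open>E\<close> apply to the differences \<open>x - b\<close>.
\<close>

definition finite_dimensional_modulo :: "('v::complex_vector \<Rightarrow> real) \<Rightarrow> 'v set \<Rightarrow> bool"
  where "finite_dimensional_modulo p E \<longleftrightarrow>
    (\<exists>B. finite B \<and> B \<subseteq> E \<and> (\<forall>x\<in>E. \<exists>b\<in>cspan B. p (x - b) = 0))"

text \<open>
  For \<open>q \<le> p\<close> this is strict singularity of the canonical map from the quotient of \<open>V\<close> by the
  kernel of \<open>p\<close>, normed by \<open>p\<close>, to the quotient by the kernel of \<open>q\<close>, normed by \<open>q\<close>. Working with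
  seminorms on one space replaces a diagram of quotient spaces by inequalities.
\<close>

definition strictly_finer ::
  "'v::complex_vector set \<Rightarrow> ('v \<Rightarrow> real) \<Rightarrow> ('v \<Rightarrow> real) \<Rightarrow> bool"
  where "strictly_finer V p q \<longleftrightarrow>
    (\<forall>E C. csubspace E \<longrightarrow> E \<subseteq> V \<longrightarrow> (\<forall>x\<in>E. p x \<le> C * q x) \<longrightarrow> finite_dimensional_modulo p E)"

lemma seminorm_onD:
  assumes "seminorm_on V p"
  shows "csubspace V" "x \<in> V \<Longrightarrow> y \<in> V \<Longrightarrow> p (x + y) \<le> p x + p y"
    "x \<in> V \<Longrightarrow> p (a *\<^sub>C x) = cmod a * p x"
  using assms by (auto simp: seminorm_on_def)

lemma seminorm_on_zero: assumes "seminorm_on V p" shows "p 0 = 0"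
  using seminorm_onD(3)[OF assms, of 0 0] complex_vector.subspace_0[OF seminorm_onD(1)[OF assms]]
  by simp

lemma seminorm_on_minus:
  assumes "seminorm_on V p" "x \<in> V" shows "p (- x) = p x"
  using seminorm_onD(3)[OF assms, of "-1"] by (simp add: scaleC_one)

lemma seminorm_on_diff:
  assumes p: "seminorm_on V p" and "x \<in> V" "y \<in> V" shows "p (x - y) \<le> p x + p y"
  using seminorm_onD(2)[OF p, of x "- y"] seminorm_on_minus[OF p, of y] assms
    complex_vector.subspace_neg[OF seminorm_onD(1)[OF p], of y] by simp

lemma seminorm_on_nonneg:
  assumes "seminorm_on V p" "x \<in> V" shows "0 \<le> p x"
  using seminorm_on_diff[OF assms assms(2)] seminorm_on_zero[OF assms(1)] by simp

lemma seminorm_on_sum: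
  assumes p: "seminorm_on V p" and "\<And>i. i \<in> I \<Longrightarrow> f i \<in> V"
  shows "p (\<Sum>i\<in>I. f i) \<le> (\<Sum>i\<in>I. p (f i))"
  using assms(2)
proof (induction I rule: infinite_finite_induct)
  case (insert i I)
  then have "(\<Sum>i\<in>I. f i) \<in> V"
    by (intro complex_vector.subspace_sum[OF seminorm_onD(1)[OF p]]) auto
  then show ?case using insert seminorm_onD(2)[OF p, of "f i" "\<Sum>i\<in>I. f i"] by auto
qed (simp_all add: seminorm_on_zero[OF p])

text \<open>
  A composition of canonical maps is strictly singular if its second factor is: a subspace
  on which \<open>q\<close> controls \<open>p\<close> is one on which \<open>q\<close> controls \<open>r\<close>, and a vector of it that \<open>r\<close>
  annihilates is annihilated by \<open>q\<close>, hence by \<open>p\<close>.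
\<close>

lemma strictly_finer_finer:
  assumes ss: "strictly_finer V r q"
    and p: "seminorm_on V p" and q: "seminorm_on V q" and r: "seminorm_on V r"
    and rp: "\<And>x. x \<in> V \<Longrightarrow> r x \<le> p x" and qr: "\<And>x. x \<in> V \<Longrightarrow> q x \<le> r x"
  shows "strictly_finer V p q"
  unfolding strictly_finer_def
proof (intro allI impI)
  fix E C assume E: "csubspace E" "E \<subseteq> V" "\<forall>x\<in>E. p x \<le> C * q x"
  then have "\<forall>x\<in>E. r x \<le> C * q x" using rp by (meson order_trans subsetD)
  then obtain B where B: "finite B" "B \<subseteq> E" "\<forall>x\<in>E. \<exists>b\<in>cspan B. r (x - b) = 0"
    using ss E unfolding strictly_finer_def finite_dimensional_modulo_def by meson
  have "\<exists>b\<in>cspan B. p (x - b) = 0" if x: "x \<in> E" for x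
  proof -
    obtain b where b: "b \<in> cspan B" "r (x - b) = 0" using B x by auto
    have "x - b \<in> E"
      using b(1) x complex_vector.span_minimal[OF B(2) E(1)]
      by (intro complex_vector.subspace_diff[OF E(1)]) auto
    then have mem: "x - b \<in> E" "x - b \<in> V" using E by auto
    have "q (x - b) = 0"
      using qr[OF mem(2)] b(2) seminorm_on_nonneg[OF q mem(2)] by simp
    then have "p (x - b) \<le> 0" using E(3) mem by fastforce
    then show ?thesis using seminorm_on_nonneg[OF p mem(2)] b(1) by (intro bexI[of _ b]) auto
  qed
  then show "finite_dimensional_modulo p E" using B unfolding finite_dimensional_modulo_def by blast
qed

lemma finite_dimensional_modulo_hyperplane:
  assumes E: "csubspace E"
    and g: "\<And>x y. g (x + y) = g x + g y" "\<And>a x. g (a *\<^sub>C x) = a * (g x :: complex)"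
    and fd: "finite_dimensional_modulo p {x\<in>E. g x = 0}"
  shows "finite_dimensional_modulo p E"
proof (cases "\<exists>e\<in>E. g e \<noteq> 0")
  case True
  then obtain e where e: "e \<in> E" "g e \<noteq> 0" by auto
  obtain B where B: "finite B" "B \<subseteq> {x\<in>E. g x = 0}"
      "\<And>x. x \<in> E \<Longrightarrow> g x = 0 \<Longrightarrow> \<exists>b\<in>cspan B. p (x - b) = 0"
    using fd unfolding finite_dimensional_modulo_def by auto
  have "\<exists>b\<in>cspan (insert e B). p (x - b) = 0" if x: "x \<in> E" for x
  proof -
    define y where "y = x + (- (g x / g e)) *\<^sub>C e"
    have "y \<in> E" unfolding y_def
      using x e by (intro complex_vector.subspace_add[OF E] complex_vector.subspace_scale[OF E])
    moreover have "g y = 0" unfolding y_def g using e by simp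
    ultimately obtain b where b: "b \<in> cspan B" "p (y - b) = 0" using B by blast
    have "b + (g x / g e) *\<^sub>C e \<in> cspan (insert e B)"
      using subsetD[OF complex_vector.span_mono[of B "insert e B"] b(1)]
      by (intro complex_vector.span_add complex_vector.span_scale)
        (auto intro: complex_vector.span_base)
    moreover have "x - (b + (g x / g e) *\<^sub>C e) = y - b" by (simp add: y_def)
    ultimately show ?thesis using b(2) by metis
  qed
  then show ?thesis
    using B e unfolding finite_dimensional_modulo_def by (intro exI[of _ "insert e B"]) auto
next
  case False
  then have "{x\<in>E. g x = 0} = E" by auto
  then show ?thesis using fd by simp
qed

lemma finite_dimensional_modulo_finite_codimension:
  assumes E: "csubspace E"
    and g: "\<And>i x y. i < (m::nat) \<Longrightarrow> g i (x + y) = g i x + g i y"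
      "\<And>i a x. i < m \<Longrightarrow> g i (a *\<^sub>C x) = a * (g i x :: complex)"
    and fd: "finite_dimensional_modulo p {x\<in>E. \<forall>i<m. g i x = 0}"
  shows "finite_dimensional_modulo p E"
  using g fd
proof (induction m)
  case (Suc m)
  let ?K = "{x\<in>E. \<forall>i<m. g i x = 0}"
  have K: "csubspace ?K"
    unfolding complex_vector.subspace_def
    using Suc.prems(1,2) complex_vector.subspace_add[OF E] complex_vector.subspace_scale[OF E]
      complex_vector.subspace_0[OF E] Suc.prems(2)[of _ 0 0]
    by auto
  have "{x\<in>E. \<forall>i<Suc m. g i x = 0} = {x\<in>?K. g m x = 0}" by (auto simp: less_Suc_eq)
  then have "finite_dimensional_modulo p ?K"
    using Suc.prems by (intro finite_dimensional_modulo_hyperplane[OF K, of "g m"]) auto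
  then show ?case using Suc by auto
qed simp

text \<open>
  The common kernel of finitely many functionals in \<open>E\<close> is still infinite-dimensional modulo
  \<open>p\<close>, so \<open>s\<close> cannot control \<open>p\<close> on it.
\<close>

lemma exists_small_vector:
  assumes ss: "strictly_finer V p s" and p: "seminorm_on V p" and s: "seminorm_on V s"
    and E: "csubspace E" "E \<subseteq> V" "\<not> finite_dimensional_modulo p E"
    and g: "\<And>i x y. i < (m::nat) \<Longrightarrow> g i (x + y) = g i x + g i y"
      "\<And>i a x. i < m \<Longrightarrow> g i (a *\<^sub>C x) = a * (g i x :: complex)"
    and e: "e > 0"
  shows "\<exists>x\<in>E. (\<forall>i<m. g i x = 0) \<and> p x = 1 \<and> s x < e"
proof -
  let ?K = "{x\<in>E. \<forall>i<m. g i x = 0}"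
  have K: "csubspace ?K"
    unfolding complex_vector.subspace_def
    using g complex_vector.subspace_add[OF E(1)] complex_vector.subspace_scale[OF E(1)]
      complex_vector.subspace_0[OF E(1)] g(2)[of _ 0 0]
    by auto
  have "\<not> finite_dimensional_modulo p ?K"
    using finite_dimensional_modulo_finite_codimension[of E m g p] E(1,3) g by blast
  then have "\<not> (\<forall>x\<in>?K. p x \<le> (1 / e) * s x)"
    using ss K E(2) unfolding strictly_finer_def by blast
  then obtain x where x: "x \<in> E" "\<And>i. i < m \<Longrightarrow> g i x = 0" "s x < e * p x"
    using e by (auto simp: field_simps not_le)
  have xV: "x \<in> V" using x E by auto
  have "e * p x > 0" using seminorm_on_nonneg[OF s xV] x(3) by simp
  then have px: "p x > 0" using e by (simp add: zero_less_mult_iff)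
  show ?thesis
  proof (intro bexI conjI allI impI)
    let ?y = "complex_of_real (1 / p x) *\<^sub>C x"
    show "?y \<in> E" using x(1) by (intro complex_vector.subspace_scale[OF E(1)])
    show "g i ?y = 0" if "i < m" for i using g(2)[OF that] x(2)[OF that] by simp
    show "p ?y = 1" using seminorm_onD(3)[OF p xV] px by (simp add: norm_divide)
    show "s ?y < e" using seminorm_onD(3)[OF s xV] px x(3) by (simp add: norm_divide field_simps)
  qed
qed

text \<open>
  The functionals need only be triangular against the vectors, not biorthogonal: solving the
  triangular system gives coefficient bounds that grow like \<open>2 ^ i\<close>, independently of the length
  of the sum. This is enough because perturbations of the vectors may be taken as small as needed,
  and it avoids extracting a basic sequence.
\<close>

lemma triangular_coefficient_bound:
  assumes p: "seminorm_on V p" and x: "\<And>j. x j \<in> V" and px: "\<And>j. p (x j) = 1"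
    and g: "\<And>i u v. g i (u + v) = g i u + g i v" "\<And>i a u. g i (a *\<^sub>C u) = a * (g i u :: complex)"
    and bound: "\<And>i u. u \<in> V \<Longrightarrow> cmod (g i u) \<le> p u"
    and diag: "\<And>i. g i (x i) = 1" and tri: "\<And>i j. i < j \<Longrightarrow> g i (x j) = 0"
    and "i < m"
  shows "cmod (a i) \<le> 2 ^ i * p (\<Sum>j<m. a j *\<^sub>C x j)"
  using \<open>i < m\<close>
proof (induction i rule: less_induct)
  case (less i)
  let ?w = "\<Sum>j<m. a j *\<^sub>C x j"
  have w: "?w \<in> V"
    using x by (intro complex_vector.subspace_sum complex_vector.subspace_scale seminorm_onD(1)[OF p])
  have zero: "g i 0 = 0" using g(2)[of i 0 0] by simp
  have "g i ?w = (\<Sum>j<m. a j * g i (x j))"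
    using sum_comp_morphism[of "g i" "\<lambda>j. a j *\<^sub>C x j" "{..<m}", OF zero g(1)]
    by (simp add: g(2) comp_def)
  also have "\<dots> = (\<Sum>j<Suc i. a j * g i (x j))"
    using less.prems by (intro sum.mono_neutral_right) (auto simp: tri less_Suc_eq not_less)
  also have "\<dots> = a i + (\<Sum>j<i. a j * g i (x j))" by (simp add: diag)
  finally have "a i = g i ?w - (\<Sum>j<i. a j * g i (x j))" by simp
  then have "cmod (a i) \<le> cmod (g i ?w) + cmod (\<Sum>j<i. a j * g i (x j))"
    by (metis norm_triangle_ineq4)
  also have "cmod (\<Sum>j<i. a j * g i (x j)) \<le> (\<Sum>j<i. 2 ^ j * p ?w)"
  proof (rule sum_norm_le)
    fix j assume "j \<in> {..<i}"
    then have "cmod (a j) \<le> 2 ^ j * p ?w" using less by auto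
    moreover have "cmod (g i (x j)) \<le> 1" using bound[OF x, of i j] px by simp
    ultimately show "cmod (a j * g i (x j)) \<le> 2 ^ j * p ?w"
      using mult_mono[of "cmod (a j)" "2 ^ j * p ?w" "cmod (g i (x j))" 1] seminorm_on_nonneg[OF p w]
      by (simp add: norm_mult)
  qed
  \<comment> \<open>The powers below \<open>2 ^ i\<close> sum to \<open>2 ^ i - 1\<close>, which leaves room for the term \<open>g i ?w\<close>.\<close>
  also have "\<dots> = (2 ^ i - 1) * p ?w"
    by (simp add: sum_distrib_right[symmetric] geometric_sum)
  also have "cmod (g i ?w) \<le> p ?w" using bound[OF w] .
  finally show ?case by (simp add: algebra_simps)
qed

lemma cspan_initial_segment:
  assumes "w \<in> cspan (y ` {..<m::nat})"
  shows "\<exists>a. w = (\<Sum>j<m. a j *\<^sub>C y j)"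
  using assms
proof (induction rule: complex_vector.span_induct_alt)
  case base
  show ?case by (intro exI[of _ "\<lambda>_. 0"]) simp
next
  case (step c x w)
  then obtain k a where k: "k < m" "x = y k" and a: "w = (\<Sum>j<m. a j *\<^sub>C y j)" by auto
  have "c *\<^sub>C x + w = (\<Sum>j<m. (if j = k then c *\<^sub>C y j else 0) + a j *\<^sub>C y j)"
    using k a by (simp add: sum.distrib)
  also have "\<dots> = (\<Sum>j<m. ((if j = k then c else 0) + a j) *\<^sub>C y j)"
    by (intro sum.cong) (auto simp: scaleC_add_left)
  finally show ?case by (intro exI[of _ "\<lambda>j. (if j = k then c else 0) + a j"])
qed

lemma cspan_range_nat:
  assumes "w \<in> cspan (range y)"
  shows "\<exists>m::nat. w \<in> cspan (y ` {..<m})"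
  using assms
proof (induction rule: complex_vector.span_induct_alt)
  case base
  show ?case by (simp add: complex_vector.span_zero)
next
  case (step c x w)
  then obtain k m where k: "x = y k" and m: "w \<in> cspan (y ` {..<m})" by auto
  have "w \<in> cspan (y ` {..<max m (Suc k)})"
    by (rule subsetD[OF complex_vector.span_mono m]) auto
  moreover have "x \<in> cspan (y ` {..<max m (Suc k)})"
    using k by (intro complex_vector.span_base) auto
  ultimately show ?case
    by (intro exI[of _ "max m (Suc k)"] complex_vector.span_add complex_vector.span_scale)
qed

lemma finite_subset_cspan_range_nat:
  assumes "finite B" "B \<subseteq> cspan (range y)"
  shows "\<exists>m::nat. B \<subseteq> cspan (y ` {..<m})"
  using assms
proof (induction B)
  case (insert b B)
  then obtain m m' where "B \<subseteq> cspan (y ` {..<m})" "b \<in> cspan (y ` {..<m'})"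
    using cspan_range_nat[of b y] by auto
  moreover have "cspan (y ` {..<m}) \<subseteq> cspan (y ` {..<max m m'})"
    "cspan (y ` {..<m'}) \<subseteq> cspan (y ` {..<max m m'})"
    by (auto intro!: complex_vector.span_mono)
  ultimately show ?case by (intro exI[of _ "max m m'"]) auto
qed auto


text \<open>
  The subspace \<open>Y\<close> plays the kernel of the quotient map with quotient seminorm \<open>s\<close>. Suppose that
  \<open>q\<close> controls \<open>p\<close> on a large space \<open>E\<close>. As \<open>s\<close> controls \<open>p\<close> on no large subspace of \<open>E\<close>, there are
  normalised vectors \<open>x j\<close> in \<open>E\<close>, linearly independent in a quantitative way, on which \<open>s\<close> is as
  small as desired; so they lie within a prescribed distance \<open>\<eta> j\<close> of vectors \<open>y j\<close> in \<open>Y\<close>.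
  If the \<open>\<eta> j\<close> decrease fast enough, replacing \<open>x j\<close> by \<open>y j\<close> changes a linear
  combination by a small fraction of its size. Hence \<open>q\<close> controls \<open>p\<close> on the span of
  the \<open>y j\<close> as well, and this span is still large, contrary to the hypothesis on \<open>Y\<close>.
\<close>

lemma strictly_finer_three_space:
  fixes V :: "'v::complex_vector set"
  assumes p: "seminorm_on V p" and q: "seminorm_on V q" and s: "seminorm_on V s"
    and qp: "\<And>x. x \<in> V \<Longrightarrow> q x \<le> p x"
    and Y: "csubspace Y" "Y \<subseteq> V"
    and dist: "\<And>x e. x \<in> V \<Longrightarrow> e > 0 \<Longrightarrow> \<exists>y\<in>Y. p (x - y) < s x + e"
    and ps: "strictly_finer V p s" and pq: "strictly_finer Y p q"
  shows "strictly_finer V p q"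
  unfolding strictly_finer_def
proof (intro allI impI, rule ccontr)
  fix E C0
  assume E: "csubspace E" "E \<subseteq> V" and C0: "\<forall>x\<in>E. p x \<le> C0 * q x"
    and inf: "\<not> finite_dimensional_modulo p E"
  note V = seminorm_onD(1)[OF p]
  define C where "C = max C0 1"
  have C: "C \<ge> 1" "\<And>x. x \<in> E \<Longrightarrow> p x \<le> C * q x"
  proof -
    fix x assume "x \<in> E"
    then have "C0 * q x \<le> C * q x"
      using seminorm_on_nonneg[OF q, of x] E(2) by (intro mult_right_mono) (auto simp: C_def)
    then show "p x \<le> C * q x" using C0 \<open>x \<in> E\<close> by fastforce
  qed (simp add: C_def)
  \<comment> \<open>The relative error \<open>\<delta>\<close> costs at most half of the lower bound \<open>p x / C\<close> for \<open>q x\<close>. The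
    factor \<open>4 ^ j\<close> in \<open>\<eta>\<close> beats the coefficient bound \<open>2 ^ j\<close> and leaves a geometric series.\<close>
  define \<delta> where "\<delta> = 1 / (2 * C)"
  have \<delta>: "0 < \<delta>" "\<delta> \<le> 1 / 2" "C * \<delta> = 1 / 2" using C(1) by (auto simp: \<delta>_def field_simps)
  define \<eta> where "\<eta> j = \<delta> / (2 * 4 ^ j)" for j :: nat
  \<comment> \<open>A triple consists of a vector of \<open>E\<close>, a functional norming it, and an approximation in \<open>Y\<close>.
    Each new vector is annihilated by the functionals chosen before it.\<close>
  define good where "good j r \<longleftrightarrow> (case r of (x, g, y) \<Rightarrow>
    x \<in> E \<and> p x = 1 \<and> y \<in> Y \<and> p (x - y) < \<eta> j \<and>
    (\<forall>u v. g (u + v) = g u + g v) \<and> (\<forall>a u. g (a *\<^sub>C u) = a * g u) \<and>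
    (\<forall>u\<in>V. cmod (g u) \<le> p u) \<and> g x = (1::complex))" for j and r :: "'v \<times> ('v \<Rightarrow> complex) \<times> 'v"
  have "\<exists>f. \<forall>j::nat. good j (f j) \<and> (\<forall>i<j. fst (snd (f i)) (fst (f j)) = 0)"
  proof (rule dependent_wf_choice[OF wf_less_than])
    fix j :: nat and f :: "nat \<Rightarrow> 'v \<times> ('v \<Rightarrow> complex) \<times> 'v"
    assume f: "\<And>i. (i, j) \<in> less_than \<Longrightarrow>
      good i (f i) \<and> (\<forall>k<i. fst (snd (f k)) (fst (f i)) = 0)"
    have \<eta>: "\<eta> j > 0" using \<delta> by (simp add: \<eta>_def)
    have "\<exists>x\<in>E. (\<forall>i<j. fst (snd (f i)) x = 0) \<and> p x = 1 \<and> s x < \<eta> j"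
    proof (rule exists_small_vector[OF ps p s E inf _ _ \<eta>])
      fix i assume "i < j"
      then have "good i (f i)" using f by simp
      then show "fst (snd (f i)) (u + v) = fst (snd (f i)) u + fst (snd (f i)) v"
        "fst (snd (f i)) (a *\<^sub>C u) = a * fst (snd (f i)) u" for u v a
        unfolding good_def by (cases "f i"; simp)+
    qed
    then obtain x where x: "x \<in> E" "\<forall>i<j. fst (snd (f i)) x = 0" "p x = 1" "s x < \<eta> j"
      by auto
    then have xV: "x \<in> V" using E by auto
    obtain y where y: "y \<in> Y" "p (x - y) < \<eta> j"
      using dist[OF xV, of "\<eta> j - s x"] x(4) by auto
    obtain g where "good j (x, g, y)"
      using exists_norming_functional[OF p xV] x y unfolding good_def by auto
    then show "\<exists>r. good j r \<and> (\<forall>i<j. fst (snd (f i)) (fst r) = 0)"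
      using x(2) by (intro exI[of _ "(x, g, y)"]) auto
  qed auto
  then obtain f where f: "\<And>j. good j (f j)" "\<And>i j. i < j \<Longrightarrow> fst (snd (f i)) (fst (f j)) = 0"
    by blast
  define x g y where "x j = fst (f j)" and "g j = fst (snd (f j))" and "y j = snd (snd (f j))" for j
  have x: "x j \<in> E" "x j \<in> V" "p (x j) = 1" and y: "y j \<in> Y" "y j \<in> V" "p (x j - y j) < \<eta> j"
    and g: "\<And>u v. g j (u + v) = g j u + g j v" "\<And>a u. g j (a *\<^sub>C u) = a * g j u"
      "\<And>u. u \<in> V \<Longrightarrow> cmod (g j u) \<le> p u" "g j (x j) = 1" for j
    using f(1)[of j] E(2) Y(2) unfolding good_def x_def g_def y_def by (auto split: prod.splits)
  have tri: "g i (x j) = 0" if "i < j" for i j using f(2)[OF that] by (simp add: x_def g_def)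
  define X where "X a m = (\<Sum>j<m. a j *\<^sub>C x j)" for a :: "nat \<Rightarrow> complex" and m
  define Z where "Z a m = (\<Sum>j<m. a j *\<^sub>C y j)" for a :: "nat \<Rightarrow> complex" and m
  have coeff: "cmod (a j) \<le> 2 ^ j * p (X a m)" if "j < m" for a j m
    unfolding X_def
    by (rule triangular_coefficient_bound[where V = V and p = p and x = x and g = g and m = m])
      (use p x g tri that in auto)
  have X: "X a m \<in> E" "X a m \<in> V" for a m
    unfolding X_def using x E(1) V
    by (auto intro!: complex_vector.subspace_sum complex_vector.subspace_scale)
  have Z: "Z a m \<in> Y" "Z a m \<in> V" for a m
    unfolding Z_def using y Y(1) V
    by (auto intro!: complex_vector.subspace_sum complex_vector.subspace_scale)
  have close: "p (X a m - Z a m) \<le> \<delta> * p (X a m)" for a m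
  proof -
    have "X a m - Z a m = (\<Sum>j<m. a j *\<^sub>C (x j - y j))"
      by (simp add: X_def Z_def sum_subtractf complex_vector.scale_right_diff_distrib)
    also have "p \<dots> \<le> (\<Sum>j<m. p (a j *\<^sub>C (x j - y j)))"
      using x y V by (intro seminorm_on_sum[OF p] complex_vector.subspace_scale
          complex_vector.subspace_diff) auto
    also have "\<dots> \<le> (\<Sum>j<m. \<delta> / 2 * p (X a m) * (1 / 2) ^ j)"
    proof (rule sum_mono)
      fix j assume "j \<in> {..<m}"
      then have "cmod (a j) \<le> 2 ^ j * p (X a m)" using coeff[of j m a] by simp
      then have "cmod (a j) * p (x j - y j) \<le> (2 ^ j * p (X a m)) * \<eta> j"
        using y(3)[of j] seminorm_on_nonneg[OF p, of "x j - y j"] x y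
          complex_vector.subspace_diff[OF V, of "x j" "y j"] seminorm_on_nonneg[OF p X(2)]
        by (intro mult_mono) (auto intro: less_imp_le)
      also have "\<dots> = \<delta> / 2 * p (X a m) * (1 / 2) ^ j"
      proof -
        have "(4::real) ^ j = 2 ^ j * 2 ^ j" by (simp add: power_mult_distrib[symmetric])
        then show ?thesis by (simp add: \<eta>_def power_one_over)
      qed
      finally show "p (a j *\<^sub>C (x j - y j)) \<le> \<delta> / 2 * p (X a m) * (1 / 2) ^ j"
        using seminorm_onD(3)[OF p, of "x j - y j" "a j"] x y
          complex_vector.subspace_diff[OF V, of "x j" "y j"] by simp
    qed
    also have "\<dots> = \<delta> / 2 * p (X a m) * (\<Sum>j<m. (1 / 2) ^ j)" by (simp add: sum_distrib_left)
    also have "\<dots> \<le> \<delta> / 2 * p (X a m) * 2"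
      using \<delta>(1) seminorm_on_nonneg[OF p X(2)]
      by (intro mult_left_mono) (auto simp: geometric_sum)
    finally show ?thesis by simp
  qed
  have E2: "csubspace (cspan (range y))" "cspan (range y) \<subseteq> Y"
    using y(1) complex_vector.span_minimal[OF _ Y(1), of "range y"] by auto
  have "p w \<le> 4 * C * q w" if span: "w \<in> cspan (range y)" for w
  proof -
    obtain m a where w: "w = Z a m"
      using cspan_range_nat[OF span] cspan_initial_segment[of w y] unfolding Z_def by blast
    let ?X = "X a m"
    have mem: "?X - w \<in> V" using complex_vector.subspace_diff[OF V] X Z w by auto
    have "p w \<le> p ?X + p (?X - w)"
      using seminorm_on_diff[OF p X(2) mem, of a m] by simp
    moreover have "q ?X \<le> q (?X - w) + q w"
      using seminorm_onD(2)[OF q mem, of w] Z w by auto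
    moreover have "q (?X - w) \<le> p (?X - w)" using qp[OF mem] .
    moreover have "p (?X - w) \<le> \<delta> * p ?X" using close w by simp
    moreover have "p ?X \<le> C * q ?X" using C(2) X by auto
    moreover have "C * q ?X \<le> C * (\<delta> * p ?X + q w)"
      using calculation C(1) by (intro mult_left_mono) auto
    moreover have "C * (\<delta> * p ?X + q w) = p ?X / 2 + C * q w"
      using \<delta>(3) by (simp add: distrib_left mult.assoc[symmetric])
    moreover have "\<delta> * p ?X \<le> 1 / 2 * p ?X"
      using \<delta>(2) seminorm_on_nonneg[OF p X(2)] by (intro mult_right_mono) auto
    ultimately show ?thesis using seminorm_on_nonneg[OF p X(2), of a m] by linarith
  qed
  then have "finite_dimensional_modulo p (cspan (range y))"
    using pq E2 unfolding strictly_finer_def by blast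
  then obtain B where B: "finite B" "B \<subseteq> cspan (range y)"
      "\<And>w. w \<in> cspan (range y) \<Longrightarrow> \<exists>b\<in>cspan B. p (w - b) = 0"
    unfolding finite_dimensional_modulo_def by blast
  \<comment> \<open>Finitely many representatives involve only finitely many \<open>y j\<close>, so some \<open>y m\<close> would be a
    combination of its predecessors modulo the kernel of \<open>p\<close>. The same combination of the \<open>x j\<close>
    would then be \<open>p\<close>-null, although its coefficient at \<open>m\<close> is \<open>1\<close>.\<close>
  obtain m where m: "B \<subseteq> cspan (y ` {..<m})" using finite_subset_cspan_range_nat[OF B(1,2)] by auto
  obtain b where b: "b \<in> cspan B" "p (y m - b) = 0"
    using B(3)[of "y m"] by (auto intro: complex_vector.span_base)
  have "b \<in> cspan (y ` {..<m})"
    using b(1) complex_vector.span_minimal[OF m complex_vector.subspace_span] by auto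
  then obtain a where a: "b = (\<Sum>j<m. a j *\<^sub>C y j)" using cspan_initial_segment by blast
  define a' where "a' j = (if j = m then 1 else - a j)" for j
  have "Z a' (Suc m) = y m - b"
    by (simp add: Z_def a a'_def sum_negf scaleC_one)
  then have "p (Z a' (Suc m)) = 0" using b by simp
  moreover have "p (X a' (Suc m)) \<le> p (X a' (Suc m) - Z a' (Suc m)) + p (Z a' (Suc m))"
    using seminorm_onD(2)[OF p complex_vector.subspace_diff[OF V X(2) Z(2)] Z(2),
        of a' "Suc m" a' "Suc m" a' "Suc m"] by simp
  moreover have "\<delta> * p (X a' (Suc m)) \<le> 1 / 2 * p (X a' (Suc m))"
    using \<delta>(2) seminorm_on_nonneg[OF p X(2)] by (intro mult_right_mono) auto
  ultimately have "p (X a' (Suc m)) \<le> 0"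
    using close[of a' "Suc m"] by linarith
  moreover have "cmod (a' m) \<le> 2 ^ m * p (X a' (Suc m))"
    using coeff[of m "Suc m" a'] by simp
  ultimately show False
    by (simp add: a'_def) (smt (verit) mult_nonneg_nonpos zero_le_power)
qed

section \<open>Strict singularity of operators between quotient spaces\<close>

text \<open>
  Taylor coefficients, and therefore jets, are linear on analytic functions only.
\<close>

definition linear_on :: "'v::complex_vector set \<Rightarrow> ('v \<Rightarrow> 'u::complex_vector) \<Rightarrow> bool"
  where "linear_on V T \<longleftrightarrow> csubspace V \<and>
    (\<forall>x\<in>V. \<forall>y\<in>V. T (x + y) = T x + T y) \<and> (\<forall>a. \<forall>x\<in>V. T (a *\<^sub>C x) = a *\<^sub>C T x)"

lemma linear_onD:
  assumes "linear_on V T"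
  shows "csubspace V" "x \<in> V \<Longrightarrow> y \<in> V \<Longrightarrow> T (x + y) = T x + T y"
    "x \<in> V \<Longrightarrow> T (a *\<^sub>C x) = a *\<^sub>C T x"
  using assms by (auto simp: linear_on_def)

lemma linear_on_zero: assumes "linear_on V T" shows "T 0 = 0"
  using linear_onD(3)[OF assms complex_vector.subspace_0[OF linear_onD(1)[OF assms]], of 0] by simp

lemma linear_on_diff:
  assumes T: "linear_on V T" and "x \<in> V" "y \<in> V" shows "T (x - y) = T x - T y"
proof -
  have "- y \<in> V" using assms complex_vector.subspace_neg[OF linear_onD(1)[OF T]] by auto
  moreover have "T (- y) = - T y" using linear_onD(3)[OF T assms(3), of "-1"] by (simp add: scaleC_one)
  ultimately show ?thesis using linear_onD(2)[OF T assms(2), of "- y"] by simp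
qed

lemma cspan_image_linear_on:
  assumes T: "linear_on V T" and B: "B \<subseteq> V"
  shows "cspan (T ` B) = T ` cspan B"
proof
  have V: "cspan B \<subseteq> V" using complex_vector.span_minimal[OF B linear_onD(1)[OF T]] .
  show "cspan (T ` B) \<subseteq> T ` cspan B"
  proof
    fix y assume "y \<in> cspan (T ` B)"
    then show "y \<in> T ` cspan B"
    proof (induction rule: complex_vector.span_induct_alt)
      case base
      then show ?case
        using linear_on_zero[OF T] complex_vector.span_zero by (metis imageI)
    next
      case (step c u w)
      then obtain x b where x: "x \<in> B" "u = T x" and b: "b \<in> cspan B" "w = T b" by auto
      have "c *\<^sub>C x + b \<in> cspan B"
        using x b by (intro complex_vector.span_add complex_vector.span_scale)
          (auto intro: complex_vector.span_base)
      moreover have "T (c *\<^sub>C x + b) = c *\<^sub>C u + w"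
        using x b B V complex_vector.subspace_scale[OF linear_onD(1)[OF T], of x c]
        by (simp add: linear_onD(2,3)[OF T] subset_iff)
      ultimately show ?case by (metis imageI)
    qed
  qed
  have "b \<in> V \<and> T b \<in> cspan (T ` B)" if "b \<in> cspan B" for b
    using that
  proof (induction rule: complex_vector.span_induct_alt)
    case base
    then show ?case
      using linear_on_zero[OF T] complex_vector.subspace_0[OF linear_onD(1)[OF T]]
      by (simp add: complex_vector.span_zero)
  next
    case (step c x b)
    have mem: "x \<in> V" "c *\<^sub>C x \<in> V" "b \<in> V"
      using step B complex_vector.subspace_scale[OF linear_onD(1)[OF T], of x c] by auto
    then have "T (c *\<^sub>C x + b) = c *\<^sub>C T x + T b"
      by (simp add: linear_onD(2,3)[OF T])
    moreover have "c *\<^sub>C T x + T b \<in> cspan (T ` B)"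
      using step by (intro complex_vector.span_add complex_vector.span_scale)
        (auto intro: complex_vector.span_base)
    ultimately show ?case
      using mem complex_vector.subspace_add[OF linear_onD(1)[OF T]] by simp
  qed
  then show "T ` cspan B \<subseteq> cspan (T ` B)" by auto
qed

lemma csubspace_image_linear_on:
  assumes T: "linear_on V T" and E: "csubspace E" "E \<subseteq> V"
  shows "csubspace (T ` E)"
proof -
  have "cspan (T ` E) = T ` E"
    using cspan_image_linear_on[OF T E(2)] complex_vector.span_eq_iff E(1) by metis
  then show ?thesis using complex_vector.subspace_span by metis
qed

lemma csubspace_preimage_linear_on:
  assumes T: "linear_on V T" and E: "csubspace E"
  shows "csubspace {x\<in>V. T x \<in> E}"
  unfolding complex_vector.subspace_def
  using linear_onD[OF T] linear_on_zero[OF T] complex_vector.subspace_0[OF E]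
    complex_vector.subspace_add[OF E] complex_vector.subspace_scale[OF E]
    complex_vector.subspace_0[OF linear_onD(1)[OF T]]
    complex_vector.subspace_add[OF linear_onD(1)[OF T]]
    complex_vector.subspace_scale[OF linear_onD(1)[OF T]]
  by auto

lemma strictly_finer_cong:
  assumes V: "csubspace V"
    and p: "\<And>x. x \<in> V \<Longrightarrow> p x = p' x" and q: "\<And>x. x \<in> V \<Longrightarrow> q x = q' x"
  shows "strictly_finer V p q \<longleftrightarrow> strictly_finer V p' q'"
proof -
  have "finite_dimensional_modulo p E \<longleftrightarrow> finite_dimensional_modulo p' E"
    if E: "csubspace E" "E \<subseteq> V" for E
  proof -
    have "p (x - b) = p' (x - b)" if "x \<in> E" "B \<subseteq> E" "b \<in> cspan B" for x b B
      using that E complex_vector.span_minimal[OF that(2) E(1)]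
      by (intro p subsetD[OF E(2)] complex_vector.subspace_diff[OF E(1)]) auto
    then show ?thesis
      unfolding finite_dimensional_modulo_def by (intro ex_cong1 conj_cong ball_cong bex_cong refl) auto
  qed
  then show ?thesis
    unfolding strictly_finer_def using p q by (auto simp: subset_iff)
qed

text \<open>
  Restricting the seminorms to a subspace that is a linear image of \<open>V\<close> amounts to pulling them
  back to \<open>V\<close>.
\<close>

lemma strictly_finer_image:
  assumes T: "linear_on V T" and ss: "strictly_finer V (\<lambda>x. p (T x)) (\<lambda>x. q (T x))"
  shows "strictly_finer (T ` V) p q"
  unfolding strictly_finer_def
proof (intro allI impI)
  fix E C assume E: "csubspace E" "E \<subseteq> T ` V" "\<forall>y\<in>E. p y \<le> C * q y"
  let ?E = "{x\<in>V. T x \<in> E}"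
  have "finite_dimensional_modulo (\<lambda>x. p (T x)) ?E"
    using ss csubspace_preimage_linear_on[OF T E(1)] E(3) unfolding strictly_finer_def by blast
  then obtain B where B: "finite B" "B \<subseteq> ?E" "\<And>x. x \<in> ?E \<Longrightarrow> \<exists>b\<in>cspan B. p (T (x - b)) = 0"
    unfolding finite_dimensional_modulo_def by blast
  have BV: "B \<subseteq> V" using B by auto
  have "\<exists>b\<in>cspan (T ` B). p (y - b) = 0" if "y \<in> E" for y
  proof -
    obtain x where x: "x \<in> V" "y = T x" using E(2) \<open>y \<in> E\<close> by blast
    then obtain b where b: "b \<in> cspan B" "p (T (x - b)) = 0" using B(3)[of x] \<open>y \<in> E\<close> by auto
    then have "b \<in> V" using complex_vector.span_minimal[OF BV linear_onD(1)[OF T]] by auto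
    then show ?thesis
      using b x linear_on_diff[OF T, of x b] cspan_image_linear_on[OF T BV] by auto
  qed
  then show "finite_dimensional_modulo p E"
    unfolding finite_dimensional_modulo_def using B by (intro exI[of _ "T ` B"]) auto
qed

lemma isomorphism_onto_image_if_bounded_below:
  assumes op: "bounded_operator_on X P Y R S" and E: "csubspace E" "E \<subseteq> X"
    and inj: "inj_on S E" and below: "\<And>x. x \<in> E \<Longrightarrow> P x \<le> C * R (S x)"
  shows "isomorphism_onto_image E P R S"
proof -
  let ?i = "inv_into E S"
  have i: "?i (S x) = x" if "x \<in> E" for x using inj that by simp
  have add: "S (x + y) = S x + S y" "x + y \<in> E" if "x \<in> E" "y \<in> E" for x y
    using op E that complex_vector.subspace_add[OF E(1)]
    by (auto simp: bounded_operator_on_def subset_iff)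
  have scale: "S (a *\<^sub>C x) = a *\<^sub>C S x" "a *\<^sub>C x \<in> E" if "x \<in> E" for a x
    using op E that complex_vector.subspace_scale[OF E(1)]
    by (auto simp: bounded_operator_on_def subset_iff)
  have "bounded_operator_on E P (S ` E) R S"
    using op E unfolding bounded_operator_on_def by (meson image_subset_iff imageI subsetD)
  moreover have "bounded_operator_on (S ` E) R E P ?i"
    unfolding bounded_operator_on_def
  proof (intro conjI ballI allI exI)
    show "?i ` S ` E \<subseteq> E" using i by auto
    show "?i (u + v) = ?i u + ?i v" if "u \<in> S ` E" "v \<in> S ` E" for u v
      using that i add by (auto simp: add(1)[symmetric])
    show "?i (a *\<^sub>C u) = a *\<^sub>C ?i u" if "u \<in> S ` E" for a u
      using that i scale by (auto simp: scale(1)[symmetric])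
    show "P (?i u) \<le> C * R u" if "u \<in> S ` E" for u
      using that i below by auto
  qed
  ultimately show ?thesis using inj by (simp add: isomorphism_onto_image_def)
qed

lemma isomorphism_onto_image_bounded_below:
  assumes "isomorphism_onto_image E P R S"
  shows "\<exists>C. \<forall>x\<in>E. P x \<le> C * R (S x)"
proof -
  have inj: "inj_on S E" and "bounded_operator_on (S ` E) R E P (inv_into E S)"
    using assms by (simp_all add: isomorphism_onto_image_def)
  then obtain C where "\<forall>u\<in>S ` E. P (inv_into E S u) \<le> C * R u"
    by (simp only: bounded_operator_on_def) (elim conjE exE)
  then show ?thesis using inv_into_f_f[OF inj] by (intro exI[of _ C]) auto
qed

text \<open>
  Subspaces \<open>E\<close> of \<open>V\<close> are pushed forward to \<open>T ` E\<close>, and subspaces of \<open>T ` V\<close> are pulled back.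
  Definiteness of \<open>P\<close> is what turns a norm estimate into injectivity of \<open>S\<close>, and makes dimension
  modulo the kernel of the pulled back seminorm the dimension of the image.
\<close>

lemma strictly_singular_iff_strictly_finer:
  assumes T: "linear_on V T" and p: "seminorm_on V (\<lambda>x. P (T x))"
    and definite: "\<And>x. x \<in> V \<Longrightarrow> P (T x) = 0 \<Longrightarrow> T x = 0"
    and op: "bounded_operator_on (T ` V) P Y R S" and q: "seminorm_on V (\<lambda>x. R (S (T x)))"
  shows "strictly_singular (T ` V) P Y R S \<longleftrightarrow>
    strictly_finer V (\<lambda>x. P (T x)) (\<lambda>x. R (S (T x)))"
proof
  assume ss: "strictly_singular (T ` V) P Y R S"
  show "strictly_finer V (\<lambda>x. P (T x)) (\<lambda>x. R (S (T x)))"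
    unfolding strictly_finer_def
  proof (intro allI impI)
    fix E C assume E: "csubspace E" "E \<subseteq> V" and le: "\<forall>x\<in>E. P (T x) \<le> C * R (S (T x))"
    note TE = csubspace_image_linear_on[OF T E]
    have S_diff: "S (T x - T y) = S (T x) - S (T y)" if "x \<in> V" "y \<in> V" for x y
    proof -
      have "linear_on (T ` V) S"
        using op csubspace_image_linear_on[OF T linear_onD(1)[OF T]]
        by (auto simp: bounded_operator_on_def linear_on_def)
      then show ?thesis using that linear_on_diff by blast
    qed
    have "inj_on S (T ` E)"
    proof (rule inj_onI)
      fix u v assume "u \<in> T ` E" "v \<in> T ` E" and eq: "S u = S v"
      then obtain x y where xy: "x \<in> E" "y \<in> E" "u = T x" "v = T y" by auto
      then have mem: "x - y \<in> E" "x \<in> V" "y \<in> V" "x - y \<in> V"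
        using complex_vector.subspace_diff[OF E(1)] E(2) by auto
      then have "S (T (x - y)) = 0" using S_diff linear_on_diff[OF T] eq xy by simp
      moreover have "R 0 = 0"
        using seminorm_on_zero[OF q] S_diff[OF mem(2,2)] linear_on_zero[OF T] by simp
      ultimately have "P (T (x - y)) \<le> 0" using le mem(1) by fastforce
      then have "T (x - y) = 0"
        using definite seminorm_on_nonneg[OF p mem(4)] mem(4) by fastforce
      then show "u = v" using linear_on_diff[OF T] mem xy by simp
    qed
    then have "isomorphism_onto_image (T ` E) P R S"
      using le E(2) by (intro isomorphism_onto_image_if_bounded_below[OF op TE]) auto
    moreover have "T ` E \<subseteq> T ` V" using E(2) by auto
    ultimately have "\<not> infinite_dimensional (T ` E)"
      using ss TE unfolding strictly_singular_def by blast
    then obtain B' where B': "finite B'" "T ` E = cspan B'"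
      unfolding infinite_dimensional_def by auto
    then have "B' \<subseteq> T ` E" using complex_vector.span_superset by blast
    then obtain B where B: "B \<subseteq> E" "finite B" "B' = T ` B"
      using finite_subset_image[OF B'(1)] by metis
    have BV: "B \<subseteq> V" using B E by auto
    have "\<exists>b\<in>cspan B. P (T (x - b)) = 0" if x: "x \<in> E" for x
    proof -
      have "T x \<in> T ` cspan B" using x B'(2) B(3) cspan_image_linear_on[OF T BV] by auto
      then obtain b where b: "b \<in> cspan B" "T x = T b" by auto
      then have "b \<in> V" using complex_vector.span_minimal[OF BV linear_onD(1)[OF T]] by auto
      then have "T (x - b) = T 0" using b x E linear_on_diff[OF T, of x b] linear_on_zero[OF T] by auto
      then have "P (T (x - b)) = 0" using seminorm_on_zero[OF p] by simp
      then show ?thesis using b(1) by blast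
    qed
    then show "finite_dimensional_modulo (\<lambda>x. P (T x)) E"
      unfolding finite_dimensional_modulo_def using B by blast
  qed
next
  assume sf: "strictly_finer V (\<lambda>x. P (T x)) (\<lambda>x. R (S (T x)))"
  show "strictly_singular (T ` V) P Y R S"
    unfolding strictly_singular_def
  proof (intro conjI op allI impI notI)
    fix E' assume "csubspace E' \<and> E' \<subseteq> T ` V \<and> infinite_dimensional E'"
      and iso: "isomorphism_onto_image E' P R S"
    then have E': "csubspace E'" "E' \<subseteq> T ` V" and inf: "infinite_dimensional E'" by auto
    let ?E = "{x\<in>V. T x \<in> E'}"
    obtain C where C: "\<forall>u\<in>E'. P u \<le> C * R (S u)"
      using isomorphism_onto_image_bounded_below[OF iso] by auto
    have "finite_dimensional_modulo (\<lambda>x. P (T x)) ?E"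
      using sf csubspace_preimage_linear_on[OF T E'(1)] C unfolding strictly_finer_def by blast
    then obtain B where B: "finite B" "B \<subseteq> ?E" "\<And>x. x \<in> ?E \<Longrightarrow> \<exists>b\<in>cspan B. P (T (x - b)) = 0"
      unfolding finite_dimensional_modulo_def by blast
    have BV: "B \<subseteq> V" using B by auto
    have "E' \<subseteq> cspan (T ` B)"
    proof
      fix u assume u: "u \<in> E'"
      then obtain x where x: "x \<in> V" "u = T x" using E' by auto
      then obtain b where b: "b \<in> cspan B" "P (T (x - b)) = 0" using B(3)[of x] u by auto
      then have bV: "b \<in> V" using complex_vector.span_minimal[OF BV linear_onD(1)[OF T]] by auto
      then have "T (x - b) = 0"
        using definite b(2) complex_vector.subspace_diff[OF linear_onD(1)[OF T] x(1)] by auto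
      then have "u = T b" using linear_on_diff[OF T x(1) bV] x(2) by simp
      then show "u \<in> cspan (T ` B)" using b(1) cspan_image_linear_on[OF T BV] by auto
    qed
    moreover have "cspan (T ` B) \<subseteq> E'"
      using B(2) by (intro complex_vector.span_minimal[OF _ E'(1)]) auto
    ultimately show False
      using inf B(1) unfolding infinite_dimensional_def by (meson finite_imageI subset_antisym)
  qed
qed

section \<open>Power series with vector coefficients\<close>

lemma bounded_bilinear_scaleC:
  "bounded_bilinear (scaleC :: complex \<Rightarrow> 'w \<Rightarrow> 'w::complex_banach)"
proof
  fix a a' :: complex and b b' :: 'w and r :: real
  show "(a + a') *\<^sub>C b = a *\<^sub>C b + a' *\<^sub>C b" by (rule scaleC_add_left)
  show "a *\<^sub>C (b + b') = a *\<^sub>C b + a *\<^sub>C b'" by (rule scaleC_add_right)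
  show "(r *\<^sub>R a) *\<^sub>C b = r *\<^sub>R (a *\<^sub>C b)"
    by (simp add: scaleR_eq_scaleC scaleC_scaleC scaleR_conv_of_real)
  show "a *\<^sub>C (r *\<^sub>R b) = r *\<^sub>R (a *\<^sub>C b)"
    by (simp add: scaleR_eq_scaleC scaleC_scaleC mult.commute)
  show "\<exists>K. \<forall>a (b::'w). norm (a *\<^sub>C b) \<le> norm a * norm b * K"
    by (intro exI[of _ 1]) (simp add: norm_scaleC)
qed

lemmas bounded_linear_scaleC_right = bounded_bilinear.bounded_linear_right[OF bounded_bilinear_scaleC]
lemmas bounded_linear_scaleC_left = bounded_bilinear.bounded_linear_left[OF bounded_bilinear_scaleC]

definition power_series_on ::
  "complex \<Rightarrow> real \<Rightarrow> (nat \<Rightarrow> 'w::complex_banach) \<Rightarrow> (complex \<Rightarrow> 'w) \<Rightarrow> bool"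
  where "power_series_on z r a f \<longleftrightarrow> (\<forall>w\<in>ball z r. (\<lambda>n. (w - z) ^ n *\<^sub>C a n) sums f w)"

lemma power_series_onD:
  "power_series_on z r a f \<Longrightarrow> w \<in> ball z r \<Longrightarrow> (\<lambda>n. (w - z) ^ n *\<^sub>C a n) sums f w"
  by (auto simp: power_series_on_def)

lemma power_series_on_mono:
  "power_series_on z r a f \<Longrightarrow> r' \<le> r \<Longrightarrow> power_series_on z r' a f"
  by (auto simp: power_series_on_def)

lemma power_series_on_cong:
  "power_series_on z r a f \<Longrightarrow> (\<And>w. w \<in> ball z r \<Longrightarrow> g w = f w) \<Longrightarrow> power_series_on z r a g"
  by (auto simp: power_series_on_def)

text \<open>
  The terms of the series at a point of larger modulus \<open>\<sigma>\<close> are bounded, which gives a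
  geometric majorant with ratio \<open>\<rho> / \<sigma>\<close>.
\<close>

lemma summable_coefficients:
  assumes ps: "power_series_on z r a f" and \<rho>: "0 \<le> \<rho>" "\<rho> < r"
  shows "summable (\<lambda>n. norm (a n) * \<rho> ^ n)"
proof -
  define \<sigma> where "\<sigma> = (\<rho> + r) / 2"
  have \<sigma>: "\<rho> < \<sigma>" "\<sigma> < r" "0 < \<sigma>" using \<rho> by (auto simp: \<sigma>_def)
  have "z + complex_of_real \<sigma> \<in> ball z r" using \<sigma> by (simp add: dist_norm)
  then have "summable (\<lambda>n. complex_of_real \<sigma> ^ n *\<^sub>C a n)"
    using power_series_onD[OF ps] by (force simp: sums_iff)
  then have "Bseq (\<lambda>n. complex_of_real \<sigma> ^ n *\<^sub>C a n)"
    using summable_LIMSEQ_zero convergent_imp_Bseq convergentI by blast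
  then obtain K where K: "\<And>n. norm (complex_of_real \<sigma> ^ n *\<^sub>C a n) \<le> K" "K > 0"
    by (auto simp: Bseq_def)
  have "summable (\<lambda>n. (\<rho> / \<sigma>) ^ n)"
    using \<rho> \<sigma> by (intro summable_geometric) simp
  then have "summable (\<lambda>n. K * (\<rho> / \<sigma>) ^ n)" by (rule summable_mult)
  then show ?thesis
  proof (rule summable_comparison_test'[of _ 0])
    fix n
    have "norm (a n) * \<rho> ^ n = (norm (complex_of_real \<sigma> ^ n *\<^sub>C a n)) * (\<rho> / \<sigma>) ^ n"
      using \<sigma> by (simp add: norm_scaleC norm_power power_divide)
    also have "\<dots> \<le> K * (\<rho> / \<sigma>) ^ n"
      using K \<rho> \<sigma> by (intro mult_right_mono) auto
    finally show "norm (norm (a n) * \<rho> ^ n) \<le> K * (\<rho> / \<sigma>) ^ n"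
      using \<rho> by simp
  qed
qed

lemma norm_summable_power_series:
  assumes "power_series_on z r a f" "w \<in> ball z r"
  shows "summable (\<lambda>n. norm ((w - z) ^ n *\<^sub>C a n))"
  using summable_coefficients[OF assms(1), of "cmod (w - z)"] assms(2)
  by (simp add: norm_scaleC norm_power dist_norm norm_minus_commute mult.commute)

lemma summable_derivative_coefficients:
  assumes ps: "power_series_on z r a f" and \<rho>: "0 \<le> \<rho>" "\<rho> < r"
  shows "summable (\<lambda>n. of_nat n * norm (a n) * \<rho> ^ (n - 1))"
proof -
  have "summable (\<lambda>n. diffs (\<lambda>n. norm (a n)) n * \<rho> ^ n)"
  proof (rule termdiff_converges[where K = r])
    fix x :: real assume "norm x < r"
    then have "summable (\<lambda>n. norm (norm (a n) * x ^ n))"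
      using summable_coefficients[OF ps, of "\<bar>x\<bar>"] by (simp add: abs_mult power_abs)
    then show "summable (\<lambda>n. norm (a n) * x ^ n)" by (rule summable_norm_cancel)
  qed (use \<rho> in simp)
  from sums_summable[OF diffs_equiv[OF this]] show ?thesis by simp
qed

text \<open>
  Term by term differentiation. The differentiated series converges uniformly on a smaller ball
  around \<open>z\<close> that still contains \<open>w\<close>.
\<close>

lemma power_series_has_derivative:
  assumes ps: "power_series_on z r a f" and w: "w \<in> ball z r"
  obtains D where "(\<lambda>n. (w - z) ^ n *\<^sub>C (of_nat (Suc n) *\<^sub>C a (Suc n))) sums D"
    and "(f has_derivative (\<lambda>h. h *\<^sub>C D)) (at w)"
proof -
  define \<rho> where "\<rho> = (dist z w + r) / 2"
  have \<rho>: "0 \<le> \<rho>" "\<rho> < r" "w \<in> ball z \<rho>" using w zero_le_dist[of z w]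
    by (auto simp: \<rho>_def simp del: zero_le_dist)
  define d where "d n x = (of_nat n * (x - z) ^ (n - 1)) *\<^sub>C a n" for n x
  have bound: "norm (d n x) \<le> of_nat n * norm (a n) * \<rho> ^ (n - 1)" if "x \<in> ball z \<rho>" for n x
  proof -
    have "cmod (x - z) ^ (n - 1) \<le> \<rho> ^ (n - 1)"
      using that by (intro power_mono) (auto simp: dist_norm norm_minus_commute)
    then have "of_nat n * norm (a n) * cmod (x - z) ^ (n - 1) \<le> of_nat n * norm (a n) * \<rho> ^ (n - 1)"
      by (intro mult_left_mono) auto
    then show ?thesis by (simp add: d_def norm_scaleC norm_mult norm_power mult_ac)
  qed
  note summ = summable_derivative_coefficients[OF ps \<rho>(1,2)]
  have unif: "uniform_limit (ball z \<rho>) (\<lambda>n x. \<Sum>i<n. d i x) (\<lambda>x. \<Sum>i. d i x) sequentially"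
    using bound summ by (rule Weierstrass_m_test)
  have der: "((\<lambda>x. (x - z) ^ n *\<^sub>C a n) has_derivative (\<lambda>h. h *\<^sub>C d n x)) (at x within ball z \<rho>)"
    for n x
  proof -
    have "((\<lambda>x. (x - z) ^ n) has_derivative (\<lambda>h. h * (of_nat n * (x - z) ^ (n - 1))))
        (at x within ball z \<rho>)"
      by (auto intro!: derivative_eq_intros simp: mult_ac)
    from bounded_linear.has_derivative[OF bounded_linear_scaleC_left this]
    show ?thesis by (simp add: d_def scaleC_scaleC)
  qed
  have "\<exists>g. \<forall>x\<in>ball z \<rho>. (\<lambda>n. (x - z) ^ n *\<^sub>C a n) sums g x \<and>
      (g has_derivative (\<lambda>h. h *\<^sub>C (\<Sum>i. d i x))) (at x within ball z \<rho>)"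
  proof (rule has_derivative_series[OF _ der _ \<rho>(3)])
    show "(\<lambda>n. (w - z) ^ n *\<^sub>C a n) sums f w" using power_series_onD[OF ps w] .
    fix e :: real assume "e > 0"
    from uniform_limitD[OF unif this]
    show "\<forall>\<^sub>F n in sequentially. \<forall>x\<in>ball z \<rho>. \<forall>h.
        norm ((\<Sum>i<n. h *\<^sub>C d i x) - h *\<^sub>C (\<Sum>i. d i x)) \<le> e * norm h"
    proof (rule eventually_mono, intro ballI allI)
      fix n x h
      assume "\<forall>x\<in>ball z \<rho>. dist (\<Sum>i<n. d i x) (\<Sum>i. d i x) < e" and "x \<in> ball z \<rho>"
      then have "norm ((\<Sum>i<n. d i x) - (\<Sum>i. d i x)) \<le> e" by (force simp: dist_norm)
      then have "norm (h *\<^sub>C ((\<Sum>i<n. d i x) - (\<Sum>i. d i x))) \<le> e * norm h"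
        using mult_right_mono[OF _ norm_ge_zero, of "norm ((\<Sum>i<n. d i x) - (\<Sum>i. d i x))" e h]
        by (simp add: norm_scaleC mult.commute)
      then show "norm ((\<Sum>i<n. h *\<^sub>C d i x) - h *\<^sub>C (\<Sum>i. d i x)) \<le> e * norm h"
        by (simp add: complex_vector.scale_right_diff_distrib complex_vector.scale_sum_right)
    qed
  qed auto
  then obtain g where g: "\<And>x. x \<in> ball z \<rho> \<Longrightarrow> (\<lambda>n. (x - z) ^ n *\<^sub>C a n) sums g x"
      "\<And>x. x \<in> ball z \<rho> \<Longrightarrow> (g has_derivative (\<lambda>h. h *\<^sub>C (\<Sum>i. d i x))) (at x within ball z \<rho>)"
    by blast
  have "g x = f x" if "x \<in> ball z \<rho>" for x
    using g(1)[OF that] power_series_onD[OF ps, of x] that \<rho>(2) by (auto intro: sums_unique2)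
  moreover have "(g has_derivative (\<lambda>h. h *\<^sub>C (\<Sum>i. d i w))) (at w)"
    using g(2)[OF \<rho>(3)] at_within_open[OF \<rho>(3) open_ball] by simp
  ultimately have "(f has_derivative (\<lambda>h. h *\<^sub>C (\<Sum>i. d i w))) (at w)"
    using has_derivative_transform_within_open[OF _ open_ball \<rho>(3)] by blast
  moreover have "(\<lambda>n. (w - z) ^ n *\<^sub>C (of_nat (Suc n) *\<^sub>C a (Suc n))) sums (\<Sum>i. d i w)"
  proof -
    have "summable (\<lambda>n. d n w)"
      using bound[OF \<rho>(3)] by (intro summable_comparison_test'[OF summ, of 0])
    then have "(\<lambda>n. d (Suc n) w) sums (\<Sum>i. d i w)"
      using sums_Suc_iff[of "\<lambda>n. d n w" "\<Sum>i. d i w"] by (simp add: d_def summable_sums)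
    then show ?thesis by (simp add: d_def scaleC_scaleC mult.commute)
  qed
  ultimately show ?thesis using that by blast
qed

lemma vderiv_eqI:
  assumes "(f has_derivative (\<lambda>h. h *\<^sub>C D)) (at w)" shows "vderiv f w = D"
proof -
  have "(f has_derivative (\<lambda>h. h *\<^sub>C vderiv f w)) (at w)"
    unfolding vderiv_def by (rule someI) (rule assms)
  from has_derivative_unique[OF this assms] have "1 *\<^sub>C vderiv f w = 1 *\<^sub>C D" by metis
  then show ?thesis by (simp add: scaleC_one)
qed

lemma power_series_on_vderiv:
  assumes "power_series_on z r a f"
  shows "power_series_on z r (\<lambda>n. of_nat (Suc n) *\<^sub>C a (Suc n)) (vderiv f)"
  unfolding power_series_on_def
proof
  fix w assume "w \<in> ball z r"
  then show "(\<lambda>n. (w - z) ^ n *\<^sub>C (of_nat (Suc n) *\<^sub>C a (Suc n))) sums vderiv f w"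
    using power_series_has_derivative[OF assms, of w] vderiv_eqI[of f _ w] by metis
qed

lemma power_series_on_funpow_vderiv:
  assumes "power_series_on z r a f"
  shows "power_series_on z r (\<lambda>n. (fact (n + i) / fact n) *\<^sub>C a (n + i)) ((vderiv ^^ i) f)"
proof (induction i)
  case 0
  then show ?case using assms by (simp add: scaleC_one)
next
  case (Suc i)
  have "of_nat (Suc n) *\<^sub>C (fact (Suc n + i) / fact (Suc n)) *\<^sub>C a (Suc n + i)
      = (fact (n + Suc i) / fact n) *\<^sub>C a (n + Suc i)" for n
    by (simp add: scaleC_scaleC divide_simps del: of_nat_Suc)
  with power_series_on_vderiv[OF Suc] show ?case by (simp only: funpow.simps comp_apply)
qed

lemma power_series_on_center:
  assumes "power_series_on z r a f" "r > 0"
  shows "f z = a 0"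
proof -
  have "(\<lambda>n. (z - z) ^ n *\<^sub>C a n) sums a 0"
  proof -
    have "(\<lambda>n. (z - z) ^ n *\<^sub>C a n) = (\<lambda>n. if n = 0 then a n else 0)"
      by (auto simp: fun_eq_iff scaleC_one)
    then show ?thesis using sums_single[of 0 a] by simp
  qed
  then show ?thesis using power_series_onD[OF assms(1), of z] assms(2) sums_unique2 by fastforce
qed

text \<open>
  Ties the iterated derivatives that define Taylor coefficients to power series, the only form in
  which analyticity is used from here on.
\<close>

lemma taylor_coeff_eq:
  assumes "power_series_on z r a f" "r > 0"
  shows "taylor_coeff f i z = a i"
  using power_series_on_center[OF power_series_on_funpow_vderiv[OF assms(1), of i] assms(2)]
  by (simp add: taylor_coeff_def scaleC_scaleC scaleC_one)

lemma power_series_on_add: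
  assumes "power_series_on z r a f" "power_series_on z r b g"
  shows "power_series_on z r (\<lambda>n. a n + b n) (f + g)"
  using assms sums_add unfolding power_series_on_def by (fastforce simp: scaleC_add_right)

lemma power_series_on_scale:
  assumes "power_series_on z r a f"
  shows "power_series_on z r (\<lambda>n. c *\<^sub>C a n) (c *\<^sub>C f)"
  unfolding power_series_on_def
proof
  fix w assume "w \<in> ball z r"
  from bounded_linear.sums[OF bounded_linear_scaleC_right power_series_onD[OF assms this], of c]
  show "(\<lambda>n. (w - z) ^ n *\<^sub>C c *\<^sub>C a n) sums (c *\<^sub>C f) w"
    by (simp add: scaleC_fun_def scaleC_scaleC mult.commute)
qed

lemma power_series_on_mult_power:
  assumes "power_series_on z r a f"
  shows "power_series_on z r (\<lambda>j. if j < m then 0 else a (j - m)) (\<lambda>w. (w - z) ^ m *\<^sub>C f w)"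
  unfolding power_series_on_def
proof
  fix w assume "w \<in> ball z r"
  from bounded_linear.sums[OF bounded_linear_scaleC_right power_series_onD[OF assms this],
      of "(w - z) ^ m"]
  have "(\<lambda>j. (w - z) ^ (j + m) *\<^sub>C a j) sums ((w - z) ^ m *\<^sub>C f w)"
    by (simp add: scaleC_scaleC power_add mult.commute)
  then show "(\<lambda>j. (w - z) ^ j *\<^sub>C (if j < m then 0 else a (j - m))) sums ((w - z) ^ m *\<^sub>C f w)"
    using sums_iff_shift[of "\<lambda>j. (w - z) ^ j *\<^sub>C (if j < m then 0 else a (j - m))" m
        "(w - z) ^ m *\<^sub>C f w"] by simp
qed

lemma power_series_on_divide_power:
  assumes ps: "power_series_on z r a f" and zero: "\<And>j. j < m \<Longrightarrow> a j = 0"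
  shows "power_series_on z r (\<lambda>j. a (j + m))
    (\<lambda>w. if w = z then a m else (1 / (w - z) ^ m) *\<^sub>C f w)"
  unfolding power_series_on_def
proof
  fix w assume w: "w \<in> ball z r"
  show "(\<lambda>j. (w - z) ^ j *\<^sub>C a (j + m)) sums (if w = z then a m else (1 / (w - z) ^ m) *\<^sub>C f w)"
  proof (cases "w = z")
    case True
    have "(\<lambda>j. (w - z) ^ j *\<^sub>C a (j + m)) = (\<lambda>j. if j = 0 then a (j + m) else 0)"
      using True by (auto simp: fun_eq_iff scaleC_one)
    then show ?thesis using sums_single[of 0 "\<lambda>j. a (j + m)"] True by simp
  next
    case False
    have "(\<lambda>j. (w - z) ^ (j + m) *\<^sub>C a (j + m)) sums f w"
      using sums_iff_shift[of "\<lambda>j. (w - z) ^ j *\<^sub>C a j" m "f w"] power_series_onD[OF ps w] zero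
      by simp
    from bounded_linear.sums[OF bounded_linear_scaleC_right this, of "1 / (w - z) ^ m"]
    show ?thesis using False by (simp add: scaleC_scaleC power_add)
  qed
qed

text \<open>
  The absolutely convergent double series is summed by rows on the one side and by
  diagonals on the other.
\<close>

lemma Cauchy_product_scaleC_sums:
  fixes a :: "nat \<Rightarrow> complex" and b :: "nat \<Rightarrow> 'w::complex_banach"
  assumes a: "summable (\<lambda>n. norm (a n))" and b: "summable (\<lambda>n. norm (b n))"
  shows "(\<lambda>n. \<Sum>i\<le>n. a i *\<^sub>C b (n - i)) sums ((\<Sum>n. a n) *\<^sub>C (\<Sum>n. b n))"
proof -
  define F where "F = (\<lambda>(i, j). a i *\<^sub>C b j)"
  define G where "G = (\<lambda>(n, i). a i *\<^sub>C b (n - i))"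
  have sumsb: "(\<lambda>j. c *\<^sub>C b j) sums (c *\<^sub>C (\<Sum>n. b n))" for c
    by (rule bounded_linear.sums[OF bounded_linear_scaleC_right
          summable_sums[OF summable_norm_cancel[OF b]]])
  have normb: "((\<lambda>j. norm (c *\<^sub>C b j)) has_sum (cmod c * (\<Sum>n. norm (b n)))) UNIV" for c
    using sums_mult[OF summable_sums[OF b], of "cmod c"]
    by (intro sums_nonneg_imp_has_sum) (simp_all add: norm_scaleC)
  have "(\<lambda>x. norm (F x)) summable_on (UNIV \<times> UNIV)"
    unfolding Infinite_Sum.abs_summable_on_Sigma_iff
  proof (intro conjI ballI)
    show "(\<lambda>j. norm (F (i, j))) summable_on UNIV" for i
      using has_sum_imp_summable[OF normb] by (simp add: F_def)
    have "(\<lambda>i. cmod (a i) * (\<Sum>n. norm (b n))) summable_on UNIV"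
      using suminf_nonneg[OF b]
      by (intro summable_nonneg_imp_summable_on summable_mult2[OF a]) simp
    then show "(\<lambda>i. norm (\<Sum>\<^sub>\<infinity>j. norm (F (i, j)))) summable_on UNIV"
      using suminf_nonneg[OF b] by (simp add: F_def infsumI[OF normb] abs_mult)
  qed
  then have Fs: "F summable_on (UNIV \<times> UNIV)" by (rule Infinite_Sum.abs_summable_summable)
  have Gs: "G summable_on (Sigma UNIV (\<lambda>n. {..n}))"
   and GF: "infsum G (Sigma UNIV (\<lambda>n. {..n})) = infsum F (UNIV \<times> UNIV)"
  proof -
    have bij: "bij_betw (\<lambda>(n, i). (i, n - i)) (Sigma UNIV (\<lambda>n. {..n})) (UNIV \<times> (UNIV :: nat set))"
      by (rule bij_betw_byWitness[where f' = "\<lambda>(i, j). (i + j, i)"]) auto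
    have "G = (\<lambda>x. F (case x of (n, i) \<Rightarrow> (i, n - i)))" by (auto simp: F_def G_def)
    then show "G summable_on (Sigma UNIV (\<lambda>n. {..n}))"
      "infsum G (Sigma UNIV (\<lambda>n. {..n})) = infsum F (UNIV \<times> UNIV)"
      using summable_on_reindex_bij_betw[OF bij, of F] infsum_reindex_bij_betw[OF bij, of F] Fs
      by auto
  qed
  have "infsum F (UNIV \<times> UNIV) = (\<Sum>\<^sub>\<infinity>i. \<Sum>\<^sub>\<infinity>j. F (i, j))"
    using infsum_Sigma_banach[OF Fs] by simp
  also have "\<dots> = (\<Sum>\<^sub>\<infinity>i. a i *\<^sub>C (\<Sum>n. b n))"
  proof (rule infsum_cong)
    fix i
    have "((\<lambda>j. F (i, j)) has_sum (a i *\<^sub>C (\<Sum>n. b n))) UNIV"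
      using sums_summable[OF has_sum_imp_sums[OF normb]] sumsb[of "a i"]
      unfolding F_def by (simp add: norm_summable_imp_has_sum)
    then show "(\<Sum>\<^sub>\<infinity>j. F (i, j)) = a i *\<^sub>C (\<Sum>n. b n)" by (rule infsumI)
  qed
  also have "\<dots> = (\<Sum>n. a n) *\<^sub>C (\<Sum>n. b n)"
  proof (rule infsumI, rule norm_summable_imp_has_sum)
    show "summable (\<lambda>i. norm (a i *\<^sub>C (\<Sum>n. b n)))"
      using summable_mult2[OF a, of "norm (\<Sum>n. b n)"] by (simp add: norm_scaleC)
    show "(\<lambda>i. a i *\<^sub>C (\<Sum>n. b n)) sums ((\<Sum>n. a n) *\<^sub>C (\<Sum>n. b n))"
      by (rule bounded_linear.sums[OF bounded_linear_scaleC_left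
            summable_sums[OF summable_norm_cancel[OF a]]])
  qed
  finally have val: "infsum G (Sigma UNIV (\<lambda>n. {..n})) = (\<Sum>n. a n) *\<^sub>C (\<Sum>n. b n)"
    using GF by simp
  have "(\<lambda>n. infsum (\<lambda>i. G (n, i)) {..n}) summable_on UNIV"
    using summable_on_Sigma_banach[of "\<lambda>n i. G (n, i)" UNIV "\<lambda>n. {..n}"] Gs by simp
  then have "((\<lambda>n. infsum (\<lambda>i. G (n, i)) {..n}) has_sum (\<Sum>n. a n) *\<^sub>C (\<Sum>n. b n)) UNIV"
    using infsum_Sigma_banach[OF Gs] val has_sum_infsum by metis
  from has_sum_imp_sums[OF this] show ?thesis by (simp add: G_def)
qed

lemma power_series_on_mult:
  assumes f: "power_series_on z r a f" and \<psi>: "\<psi> holomorphic_on ball z r"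
  shows "\<exists>b. power_series_on z r b (\<lambda>w. \<psi> w *\<^sub>C f w)"
proof -
  define c where "c n = (deriv ^^ n) \<psi> z / fact n" for n
  have "(\<lambda>n. (w - z) ^ n *\<^sub>C (\<Sum>i\<le>n. c i *\<^sub>C a (n - i))) sums (\<psi> w *\<^sub>C f w)" if w: "w \<in> ball z r" for w
  proof -
    have c: "(\<lambda>n. c n * (w - z) ^ n) sums \<psi> w"
      using holomorphic_power_series[OF \<psi> w] by (simp add: c_def)
    have "summable (\<lambda>n. norm (c n * (w - z) ^ n))"
    proof -
      obtain \<sigma> where \<sigma>: "dist z w < \<sigma>" "\<sigma> < r" using w dense[of "dist z w" r] by auto
      have "0 < \<sigma>" using \<sigma>(1) zero_le_dist[of z w] by linarith
      then have "z + complex_of_real \<sigma> \<in> ball z r" using \<sigma> by (simp add: dist_norm)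
      from holomorphic_power_series[OF \<psi> this] have "summable (\<lambda>n. c n * complex_of_real \<sigma> ^ n)"
        by (simp add: c_def sums_iff)
      then show ?thesis
        by (rule powser_insidea) (use \<sigma> \<open>0 < \<sigma>\<close> in \<open>simp add: dist_norm norm_minus_commute\<close>)
    qed
    from Cauchy_product_scaleC_sums[OF this norm_summable_power_series[OF f w]]
    have "(\<lambda>n. \<Sum>i\<le>n. (c i * (w - z) ^ i) *\<^sub>C (w - z) ^ (n - i) *\<^sub>C a (n - i)) sums (\<psi> w *\<^sub>C f w)"
      using sums_unique[OF c] sums_unique[OF power_series_onD[OF f w]] by simp
    moreover have "(\<Sum>i\<le>n. (c i * (w - z) ^ i) *\<^sub>C (w - z) ^ (n - i) *\<^sub>C a (n - i))
        = (w - z) ^ n *\<^sub>C (\<Sum>i\<le>n. c i *\<^sub>C a (n - i))" for n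
      unfolding complex_vector.scale_sum_right
      by (intro sum.cong) (auto simp: scaleC_scaleC power_add[symmetric] mult_ac
          intro!: arg_cong[of _ _ "\<lambda>x. x *\<^sub>C _"])
    ultimately show ?thesis by simp
  qed
  then show ?thesis
    unfolding power_series_on_def
    by (intro exI[of _ "\<lambda>n. \<Sum>i\<le>n. c i *\<^sub>C a (n - i)"]) simp
qed

section \<open>Analytic functions and a conformal coordinate\<close>

lemma analytic_function_iff_power_series:
  "analytic_function U f \<longleftrightarrow> (\<forall>w. w \<notin> U \<longrightarrow> f w = 0) \<and>
    (\<forall>z\<in>U. \<exists>r>0. \<exists>a. ball z r \<subseteq> U \<and> power_series_on z r a f)"
  by (simp add: analytic_function_def power_series_on_def)

lemma analytic_functionD:
  assumes "analytic_function U f"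
  shows "w \<notin> U \<Longrightarrow> f w = 0"
    and "z \<in> U \<Longrightarrow> \<exists>r>0. \<exists>a. ball z r \<subseteq> U \<and> power_series_on z r a f"
  using assms unfolding analytic_function_iff_power_series by blast+

lemma analytic_function_mult:
  assumes f: "analytic_function U f" and \<psi>: "\<psi> holomorphic_on U"
  shows "analytic_function U (\<lambda>w. \<psi> w *\<^sub>C f w)"
  unfolding analytic_function_iff_power_series
proof (intro conjI allI impI ballI)
  show "\<psi> w *\<^sub>C f w = 0" if "w \<notin> U" for w using analytic_functionD(1)[OF f that] by simp
  fix z assume "z \<in> U"
  then obtain r a where ra: "r > 0" "ball z r \<subseteq> U" "power_series_on z r a f"
    using analytic_functionD(2)[OF f] by blast
  then show "\<exists>r>0. \<exists>a. ball z r \<subseteq> U \<and> power_series_on z r a (\<lambda>w. \<psi> w *\<^sub>C f w)"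
    using power_series_on_mult[OF ra(3) holomorphic_on_subset[OF \<psi> ra(2)]] by blast
qed

lemma taylor_coeff_add:
  assumes f: "analytic_function U f" and g: "analytic_function U g" and z: "z \<in> U"
  shows "taylor_coeff (f + g) i z = taylor_coeff f i z + taylor_coeff g i z"
proof -
  obtain r a where a: "r > 0" "power_series_on z r a f" using analytic_functionD(2)[OF f z] by blast
  obtain s b where b: "s > 0" "power_series_on z s b g" using analytic_functionD(2)[OF g z] by blast
  have "power_series_on z (min r s) (\<lambda>n. a n + b n) (f + g)"
    using a b by (intro power_series_on_add) (auto elim: power_series_on_mono)
  then have "taylor_coeff (f + g) i z = a i + b i"
    by (rule taylor_coeff_eq) (simp add: a b)
  then show ?thesis
    using taylor_coeff_eq[OF a(2,1)] taylor_coeff_eq[OF b(2,1)] by simp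
qed

lemma taylor_coeff_scale:
  assumes f: "analytic_function U f" and z: "z \<in> U"
  shows "taylor_coeff (c *\<^sub>C f) i z = c *\<^sub>C taylor_coeff f i z"
proof -
  obtain r a where a: "r > 0" "power_series_on z r a f" using analytic_functionD(2)[OF f z] by blast
  then show ?thesis
    using taylor_coeff_eq[OF power_series_on_scale[OF a(2), of c] a(1)] taylor_coeff_eq[OF a(2,1)]
    by simp
qed

lemma taylor_coeff_zero_order:
  assumes f: "analytic_function U f" and z: "z \<in> U"
  shows "taylor_coeff f 0 z = f z"
proof -
  obtain r a where a: "r > 0" "power_series_on z r a f" using analytic_functionD(2)[OF f z] by blast
  then show ?thesis using taylor_coeff_eq[OF a(2,1)] power_series_on_center[OF a(2,1)] by simp
qed

lemma taylor_coeff_mult_power: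
  assumes f: "analytic_function U f" and z: "z \<in> U" and "i < m"
  shows "taylor_coeff (\<lambda>w. (w - z) ^ m *\<^sub>C f w) i z = 0"
proof -
  obtain r a where a: "r > 0" "power_series_on z r a f" using analytic_functionD(2)[OF f z] by blast
  then show ?thesis
    using taylor_coeff_eq[OF power_series_on_mult_power[OF a(2), of m] a(1), of i] \<open>i < m\<close> by simp
qed

text \<open>
  At \<open>z\<close> the power series of \<open>f\<close> is shifted; elsewhere \<open>1 / (w - z) ^ m\<close> is a holomorphic factor.
\<close>

lemma analytic_function_divide_power:
  assumes f: "analytic_function U f" and z: "z \<in> U"
    and zero: "\<And>i. i < m \<Longrightarrow> taylor_coeff f i z = 0"
  obtains h where "analytic_function U h" "f = (\<lambda>w. (w - z) ^ m *\<^sub>C h w)"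
proof -
  obtain r a where a: "r > 0" "ball z r \<subseteq> U" "power_series_on z r a f"
    using analytic_functionD(2)[OF f z] by blast
  have a0: "a i = 0" if "i < m" for i using zero[OF that] taylor_coeff_eq[OF a(3,1)] by simp
  define h where "h w = (if w = z then a m else (1 / (w - z) ^ m) *\<^sub>C f w)" for w
  have "analytic_function U h"
    unfolding analytic_function_iff_power_series
  proof (intro conjI allI impI ballI)
    show "h w = 0" if "w \<notin> U" for w using analytic_functionD(1)[OF f that] that z by (auto simp: h_def)
    fix u assume u: "u \<in> U"
    show "\<exists>r>0. \<exists>a. ball u r \<subseteq> U \<and> power_series_on u r a h"
    proof (cases "u = z")
      case True
      have "power_series_on z r (\<lambda>j. a (j + m)) h"
        using power_series_on_divide_power[OF a(3) a0] unfolding h_def .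
      then show ?thesis using True a by blast
    next
      case False
      obtain s b where b: "s > 0" "ball u s \<subseteq> U" "power_series_on u s b f"
        using analytic_functionD(2)[OF f u] by blast
      define t where "t = min s (dist u z)"
      have t: "t > 0" "ball u t \<subseteq> U" "z \<notin> ball u t" using b False by (auto simp: t_def)
      have "(\<lambda>w. 1 / (w - z) ^ m) holomorphic_on ball u t"
        using t(3) by (auto intro!: holomorphic_intros)
      moreover have "power_series_on u t b f"
        using b(3) by (rule power_series_on_mono) (simp add: t_def)
      ultimately obtain c where "power_series_on u t c (\<lambda>w. (1 / (w - z) ^ m) *\<^sub>C f w)"
        using power_series_on_mult by blast
      then have "power_series_on u t c h"
        using t(3) by (elim power_series_on_cong) (auto simp: h_def)
      then show ?thesis using t by blast
    qed
  qed
  moreover have "f w = (w - z) ^ m *\<^sub>C h w" for w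
  proof (cases "w = z")
    case True
    then show ?thesis
      using power_series_on_center[OF a(3,1)] a0[of 0]
      by (cases "m = 0") (auto simp: h_def scaleC_one)
  qed (simp add: h_def scaleC_scaleC scaleC_one)
  ultimately show ?thesis using that by blast
qed

text \<open>
  A disc automorphism moves the image of \<open>z\<close> to the origin.
\<close>

lemma conformal_equivalence_centred:
  assumes \<phi>: "conformal_equivalence \<phi> U (ball 0 1)" and z: "z \<in> U"
  obtains \<psi> where "conformal_equivalence \<psi> U (ball 0 1)" "\<psi> z = 0"
proof -
  have bij: "bij_betw \<phi> U (ball 0 1)" and hol: "\<phi> holomorphic_on U"
    and inv: "inv_into U \<phi> holomorphic_on ball 0 1"
    using \<phi> by (auto simp: conformal_equivalence_def)
  have "\<phi> z \<in> ball 0 1" using bij z by (auto simp: bij_betw_def)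
  then obtain f g where fg: "f (\<phi> z) = 0" "f holomorphic_on ball 0 1" "f ` ball 0 1 \<subseteq> ball 0 1"
      "g holomorphic_on ball 0 1" "g ` ball 0 1 \<subseteq> ball 0 1"
      "\<And>w. w \<in> ball 0 1 \<Longrightarrow> f (g w) = w" "\<And>w. w \<in> ball 0 1 \<Longrightarrow> g (f w) = w"
    by (rule ball_biholomorphism_exists) blast
  have "bij_betw f (ball 0 1) (ball 0 1)"
    by (rule bij_betw_byWitness[where f' = g]) (use fg in auto)
  then have bij': "bij_betw (f \<circ> \<phi>) U (ball 0 1)" using bij bij_betw_trans by blast
  have "inv_into U (f \<circ> \<phi>) w = inv_into U \<phi> (g w)" if w: "w \<in> ball 0 1" for w
  proof (rule inv_into_f_eq)
    have gw: "g w \<in> \<phi> ` U" using fg(5) w bij unfolding bij_betw_def by blast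
    show "inj_on (f \<circ> \<phi>) U" using bij' by (auto simp: bij_betw_def)
    show "inv_into U \<phi> (g w) \<in> U" using gw by (rule inv_into_into)
    show "(f \<circ> \<phi>) (inv_into U \<phi> (g w)) = w" using f_inv_into_f[OF gw] fg(6)[OF w] by simp
  qed
  moreover have "inv_into U \<phi> \<circ> g holomorphic_on ball 0 1"
    using holomorphic_on_compose_gen[OF fg(4) inv fg(5)] .
  ultimately have "inv_into U (f \<circ> \<phi>) holomorphic_on ball 0 1"
    by (metis (no_types, lifting) comp_apply holomorphic_transform)
  moreover have "f \<circ> \<phi> holomorphic_on U"
    using holomorphic_on_compose_gen[OF hol fg(2)] bij by (auto simp: bij_betw_def)
  ultimately have "conformal_equivalence (f \<circ> \<phi>) U (ball 0 1)"
    using bij' by (auto simp: conformal_equivalence_def)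
  then show ?thesis using that[of "f \<circ> \<phi>"] fg(1) by simp
qed

text \<open>
  An injective holomorphic function has simple zeros, so multiplication by \<open>\<phi>\<close> and by \<open>w - z\<close>
  differ by an invertible factor.
\<close>

lemma conformal_equivalence_simple_zero:
  assumes \<phi>: "conformal_equivalence \<phi> U V" and U: "open U" and z: "z \<in> U" "\<phi> z = 0"
  obtains \<kappa> where "\<kappa> holomorphic_on U" "\<And>w. w \<in> U \<Longrightarrow> \<kappa> w \<noteq> 0" "\<And>w. \<phi> w = (w - z) * \<kappa> w"
proof -
  have inj: "inj_on \<phi> U" and hol: "\<phi> holomorphic_on U"
    using \<phi> by (auto simp: conformal_equivalence_def bij_betw_def)
  define \<kappa> where "\<kappa> w = (if w = z then deriv \<phi> z else (\<phi> w - \<phi> z) / (w - z))" for w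
  have "\<kappa> holomorphic_on U" unfolding \<kappa>_def using hol U by (rule pole_lemma_open)
  moreover have "\<kappa> w \<noteq> 0" if "w \<in> U" for w
  proof (cases "w = z")
    case True
    then show ?thesis
      using holomorphic_injective_imp_regular[OF hol U inj z(1)] by (simp add: \<kappa>_def)
  next
    case False
    then have "\<phi> w \<noteq> 0" using inj_on_eq_iff[OF inj that z(1)] z(2) by simp
    then show ?thesis using False z(2) by (simp add: \<kappa>_def)
  qed
  moreover have "\<phi> w = (w - z) * \<kappa> w" for w using z(2) by (simp add: \<kappa>_def)
  ultimately show ?thesis using that by blast
qed

section \<open>Jets as quotients of the function space\<close>

locale centred_admissible_space = admissible_space U F N
  for U :: "complex set"
    and F :: "(complex \<Rightarrow> 'w::complex_banach) set"
    and N :: "(complex \<Rightarrow> 'w) \<Rightarrow> real" +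
  fixes \<phi> :: "complex \<Rightarrow> complex" and z :: complex
  assumes open_U: "open U" and z_in: "z \<in> U"
    and conformal: "conformal_equivalence \<phi> U (ball 0 1)" and \<phi>_z: "\<phi> z = 0"
begin

definition mult_power :: "nat \<Rightarrow> (complex \<Rightarrow> 'w) \<Rightarrow> complex \<Rightarrow> 'w"
  where "mult_power m g = (\<lambda>w. \<phi> w ^ m *\<^sub>C g w)"

definition jet :: "nat \<Rightarrow> (complex \<Rightarrow> 'w) \<Rightarrow> nat \<Rightarrow> 'w"
  where "jet m f = (\<lambda>i. if i < m then taylor_coeff f i z else 0)"

text \<open>
  The distance from \<open>f\<close> to the functions in \<open>F\<close> that vanish to order \<open>m\<close> at \<open>z\<close>, which are the
  multiples of \<open>\<phi> ^ m\<close>; in other words the quotient norm of the \<open>m\<close>-jet of \<open>f\<close>.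
\<close>

definition dist_power :: "nat \<Rightarrow> (complex \<Rightarrow> 'w) \<Rightarrow> real"
  where "dist_power m f = (INF g\<in>F. N (f - mult_power m g))"

lemma mult_power_0: "mult_power 0 g = g"
  by (simp add: mult_power_def scaleC_one)

lemma mult_power_add: "mult_power (k + m) g = mult_power k (mult_power m g)"
  by (simp add: mult_power_def scaleC_scaleC power_add)

lemma linear_on_mult_power: "csubspace V \<Longrightarrow> linear_on V (mult_power m)"
  by (auto simp: linear_on_def mult_power_def scaleC_fun_def fun_eq_iff scaleC_add_right
      scaleC_scaleC mult.commute)

lemma holomorphic_\<phi>: "\<phi> holomorphic_on U"
  using conformal by (simp add: conformal_equivalence_def)

lemma analytic_mult_power: "analytic_function U g \<Longrightarrow> analytic_function U (mult_power m g)"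
  unfolding mult_power_def by (intro analytic_function_mult holomorphic_intros holomorphic_\<phi>)

lemma mult_power_in_iff: "analytic_function U g \<Longrightarrow> mult_power m g \<in> F \<longleftrightarrow> g \<in> F"
proof (induction m)
  case (Suc m)
  have "mult_power (Suc m) g = (\<lambda>w. \<phi> w *\<^sub>C mult_power m g w)"
    by (simp add: mult_power_def scaleC_scaleC)
  then show ?case
    using mult_conformal_iff[OF conformal analytic_mult_power[OF Suc.prems, of m]] Suc by simp
qed (simp add: mult_power_0)

lemma mult_power_in: "g \<in> F \<Longrightarrow> mult_power m g \<in> F"
  using mult_power_in_iff analytic by blast

lemma norm_mult_power: "g \<in> F \<Longrightarrow> N (mult_power m g) = N g"
proof (induction m)
  case (Suc m)
  have "mult_power (Suc m) g = (\<lambda>w. \<phi> w *\<^sub>C mult_power m g w)"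
    by (simp add: mult_power_def scaleC_scaleC)
  then show ?case
    using norm_mult_conformal[OF conformal mult_power_in[OF Suc.prems, of m]] Suc by simp
qed (simp add: mult_power_0)

text \<open>
  This is where admissibility enters algebraically: a function in \<open>F\<close> that vanishes to order \<open>m\<close>
  has an analytic quotient by \<open>\<phi> ^ m\<close>, and this quotient belongs to \<open>F\<close> again.
\<close>

lemma vanishing_iff_mult_power:
  assumes f: "f \<in> F"
  shows "(\<forall>i<m. taylor_coeff f i z = 0) \<longleftrightarrow> (\<exists>g\<in>F. f = mult_power m g)"
proof -
  obtain \<kappa> where \<kappa>: "\<kappa> holomorphic_on U" "\<And>w. w \<in> U \<Longrightarrow> \<kappa> w \<noteq> 0" "\<And>w. \<phi> w = (w - z) * \<kappa> w"
    using conformal_equivalence_simple_zero[OF conformal open_U z_in \<phi>_z] by blast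
  show ?thesis
  proof
    assume "\<forall>i<m. taylor_coeff f i z = 0"
    then obtain h where h: "analytic_function U h" "f = (\<lambda>w. (w - z) ^ m *\<^sub>C h w)"
      using analytic_function_divide_power[OF analytic[OF f] z_in] by blast
    define g where "g = (\<lambda>w. (1 / \<kappa> w ^ m) *\<^sub>C h w)"
    have "analytic_function U g"
      unfolding g_def using h(1) \<kappa>(1,2) by (intro analytic_function_mult holomorphic_intros) auto
    moreover have "f = mult_power m g"
    proof
      fix w show "f w = mult_power m g w"
      proof (cases "w \<in> U")
        case True
        then show ?thesis using \<kappa>(2) h(2)
          by (simp add: mult_power_def g_def \<kappa>(3) scaleC_scaleC power_mult_distrib)
      next
        case False
        then show ?thesis
          using analytic_functionD(1)[OF analytic[OF f]] analytic_functionD(1)[OF \<open>analytic_function U g\<close>]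
          by (simp add: mult_power_def)
      qed
    qed
    ultimately show "\<exists>g\<in>F. f = mult_power m g" using mult_power_in_iff f by blast
  next
    assume "\<exists>g\<in>F. f = mult_power m g"
    then obtain g where g: "g \<in> F" "f = mult_power m g" by blast
    have "f = (\<lambda>w. (w - z) ^ m *\<^sub>C (\<kappa> w ^ m *\<^sub>C g w))"
      by (simp add: g mult_power_def \<kappa>(3) scaleC_scaleC power_mult_distrib)
    moreover have "analytic_function U (\<lambda>w. \<kappa> w ^ m *\<^sub>C g w)"
      using analytic[OF g(1)] \<kappa>(1) by (intro analytic_function_mult holomorphic_intros)
    ultimately show "\<forall>i<m. taylor_coeff f i z = 0" using taylor_coeff_mult_power[OF _ z_in] by metis
  qed
qed

lemma linear_on_jet: "linear_on F (jet m)"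
  unfolding linear_on_def
proof (intro conjI ballI allI subspace)
  fix f assume f: "f \<in> F"
  show "jet m (f + g) = jet m f + jet m g" if "g \<in> F" for g
    by (simp add: jet_def fun_eq_iff taylor_coeff_add[OF analytic[OF f] analytic[OF that] z_in])
  show "jet m (a *\<^sub>C f) = a *\<^sub>C jet m f" for a
    by (simp add: jet_def fun_eq_iff scaleC_fun_def
        taylor_coeff_scale[OF analytic[OF f] z_in, unfolded scaleC_fun_def])
qed

lemma diff_in: "f \<in> F \<Longrightarrow> g \<in> F \<Longrightarrow> f - g \<in> F"
  using complex_vector.subspace_diff[OF subspace] .

lemma jet_eq_zero_iff: "f \<in> F \<Longrightarrow> jet m f = 0 \<longleftrightarrow> (\<exists>g\<in>F. f = mult_power m g)"
  using vanishing_iff_mult_power[of f m] by (auto simp: jet_def fun_eq_iff)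

lemma jet_space_eq: "jet_space F z m = jet m ` F"
proof (intro set_eqI iffI)
  fix x assume "x \<in> jet_space F z m"
  then obtain f where "f \<in> F" "\<forall>i<m. x i = taylor_coeff f i z" "\<forall>i\<ge>m. x i = 0"
    by (auto simp: jet_space_def)
  then show "x \<in> jet m ` F" by (intro image_eqI[of _ _ f]) (auto simp: jet_def)
qed (auto simp: jet_space_def jet_def)

lemma jet_proj_jet: "k \<le> m \<Longrightarrow> jet_proj k (jet m f) = jet k f"
  by (auto simp: jet_proj_def jet_def)

text \<open>
  The functions with the same \<open>m\<close>-jet as \<open>f\<close> form the coset of \<open>f\<close> modulo the multiples of
  \<open>\<phi> ^ m\<close>.
\<close>

lemma jet_norm_jet:
  assumes f: "f \<in> F"
  shows "jet_norm F N z m (jet m f) = dist_power m f"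
proof -
  have "{f'\<in>F. \<forall>i<m. jet m f i = taylor_coeff f' i z} = (\<lambda>g. f - mult_power m g) ` F"
  proof (intro set_eqI iffI)
    fix f' assume f': "f' \<in> {f'\<in>F. \<forall>i<m. jet m f i = taylor_coeff f' i z}"
    then have "jet m f = jet m f'" by (auto simp: jet_def)
    then have "jet m (f - f') = 0" using linear_on_diff[OF linear_on_jet f, of f'] f' by simp
    then obtain g where "g \<in> F" "f - f' = mult_power m g"
      using jet_eq_zero_iff[of "f - f'"] diff_in f f' by auto
    then show "f' \<in> (\<lambda>g. f - mult_power m g) ` F" by (intro image_eqI[of _ _ g]) (auto simp: algebra_simps)
  next
    fix f' assume "f' \<in> (\<lambda>g. f - mult_power m g) ` F"
    then obtain g where g: "g \<in> F" "f' = f - mult_power m g" by auto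
    then have f': "f' \<in> F" using diff_in f mult_power_in by auto
    have "jet m (f - f') = 0"
      using g jet_eq_zero_iff[of "f - f'" m] diff_in[OF f f'] by auto
    then have "jet m f = jet m f'" using linear_on_diff[OF linear_on_jet f f'] by simp
    then show "f' \<in> {f'\<in>F. \<forall>i<m. jet m f i = taylor_coeff f' i z}"
      using f' by (auto simp: jet_def fun_eq_iff)
  qed
  then show ?thesis by (simp add: jet_norm_def dist_power_def image_image)
qed

lemma zero_in: "0 \<in> F"
  using complex_vector.subspace_0[OF subspace] .

lemma mult_power_zero: "mult_power m 0 = 0"
  by (auto simp: mult_power_def fun_eq_iff)

lemma dist_power_le: "f \<in> F \<Longrightarrow> g \<in> F \<Longrightarrow> dist_power m f \<le> N (f - mult_power m g)"
  unfolding dist_power_def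
  by (rule cINF_lower) (auto intro!: bdd_belowI2[of _ 0] norm_ge_zero diff_in mult_power_in)

lemma dist_power_greatest: "(\<And>g. g \<in> F \<Longrightarrow> c \<le> N (f - mult_power m g)) \<Longrightarrow> c \<le> dist_power m f"
  unfolding dist_power_def using zero_in by (intro cINF_greatest) auto

lemma dist_power_approx:
  assumes "e > 0"
  shows "\<exists>g\<in>F. N (f - mult_power m g) < dist_power m f + e"
proof (rule ccontr)
  assume "\<not> ?thesis"
  then have "dist_power m f + e \<le> dist_power m f" by (intro dist_power_greatest) (auto simp: not_less)
  then show False using assms by simp
qed

lemma dist_power_le_norm: "f \<in> F \<Longrightarrow> dist_power m f \<le> N f"
  using dist_power_le[OF _ zero_in, of f m] by (simp add: mult_power_zero)

lemma dist_power_nonneg: "f \<in> F \<Longrightarrow> 0 \<le> dist_power m f"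
  by (intro dist_power_greatest norm_ge_zero diff_in mult_power_in)

lemma seminorm_on_dist_power: "seminorm_on F (dist_power m)"
  unfolding seminorm_on_def
proof (intro conjI ballI allI subspace)
  note M = linear_onD[OF linear_on_mult_power[OF subspace, of m]]
  fix f f' assume f: "f \<in> F" "f' \<in> F"
  show "dist_power m (f + f') \<le> dist_power m f + dist_power m f'"
  proof (rule field_le_epsilon)
    fix e :: real assume "e > 0"
    then obtain g g' where g: "g \<in> F" "g' \<in> F" "N (f - mult_power m g) < dist_power m f + e / 2"
        "N (f' - mult_power m g') < dist_power m f' + e / 2"
      using dist_power_approx[of "e / 2"] by (metis half_gt_zero)
    have "dist_power m (f + f') \<le> N ((f + f') - mult_power m (g + g'))"
      using f g complex_vector.subspace_add[OF subspace] by (intro dist_power_le) auto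
    also have "(f + f') - mult_power m (g + g') = (f - mult_power m g) + (f' - mult_power m g')"
      using M(2)[of g g'] g by (simp add: algebra_simps)
    also have "N \<dots> \<le> N (f - mult_power m g) + N (f' - mult_power m g')"
      using f g by (intro norm_triangle diff_in mult_power_in)
    finally show "dist_power m (f + f') \<le> dist_power m f + dist_power m f' + e" using g by linarith
  qed
next
  note M = linear_onD[OF linear_on_mult_power[OF subspace, of m]]
  have le: "dist_power m (a *\<^sub>C f) \<le> cmod a * dist_power m f" if f: "f \<in> F" for a f
  proof (rule field_le_epsilon)
    fix e :: real assume "e > 0"
    define d where "d = e / (cmod a + 1)"
    have a1: "cmod a + 1 > 0" by (simp add: add_nonneg_pos)
    have d: "d > 0" using \<open>e > 0\<close> a1 by (simp add: d_def)
    obtain g where g: "g \<in> F" "N (f - mult_power m g) < dist_power m f + d"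
      using dist_power_approx[OF d] by blast
    have "dist_power m (a *\<^sub>C f) \<le> N (a *\<^sub>C f - mult_power m (a *\<^sub>C g))"
      using f g complex_vector.subspace_scale[OF subspace] by (intro dist_power_le) auto
    also have "a *\<^sub>C f - mult_power m (a *\<^sub>C g) = a *\<^sub>C (f - mult_power m g)"
      using M(3)[OF g(1), of a] by (simp add: complex_vector.scale_right_diff_distrib)
    also have "N \<dots> = cmod a * N (f - mult_power m g)"
      using f g by (intro norm_scale diff_in mult_power_in)
    also have "\<dots> \<le> cmod a * (dist_power m f + d)" using g by (intro mult_left_mono) auto
    also have "\<dots> \<le> cmod a * dist_power m f + (cmod a + 1) * d" using d by (simp add: algebra_simps)
    also have "(cmod a + 1) * d = e" using a1 by (simp add: d_def)
    finally show "dist_power m (a *\<^sub>C f) \<le> cmod a * dist_power m f + e" .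
  qed
  fix a f assume f: "f \<in> F"
  show "dist_power m (a *\<^sub>C f) = cmod a * dist_power m f"
  proof (cases "a = 0")
    case True
    then show ?thesis using le[OF f, of 0] dist_power_nonneg[OF zero_in] by (simp add: order_antisym)
  next
    case False
    have "dist_power m f \<le> cmod (1 / a) * dist_power m (a *\<^sub>C f)"
      using le[of "a *\<^sub>C f" "1 / a"] complex_vector.subspace_scale[OF subspace f] False
      by (simp add: scaleC_scaleC scaleC_one)
    then show ?thesis using le[OF f, of a] False by (simp add: norm_divide field_simps)
  qed
qed

lemma dist_power_mono:
  assumes "k \<le> m" "f \<in> F" shows "dist_power k f \<le> dist_power m f"
proof (rule dist_power_greatest)
  fix g assume "g \<in> F"
  then show "dist_power k f \<le> N (f - mult_power m g)"
    using dist_power_le[OF assms(2) mult_power_in, of g k "m - k"] mult_power_add[of k "m - k" g] assms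
    by simp
qed

text \<open>
  Multiplication by \<open>\<phi>\<close> induces an isometry from \<open>m\<close>-jets onto the \<open>(m + 1)\<close>-jets that vanish at
  \<open>z\<close>.
\<close>

lemma dist_power_mult:
  assumes f: "f \<in> F" shows "dist_power (Suc m) (mult_power 1 f) = dist_power m f"
proof -
  have "N (mult_power 1 f - mult_power (Suc m) g) = N (f - mult_power m g)" if "g \<in> F" for g
    using linear_on_diff[OF linear_on_mult_power[OF subspace] f mult_power_in[OF that], of 1 m]
      mult_power_add[of 1 m g] norm_mult_power[OF diff_in[OF f mult_power_in[OF that]], of 1 m]
    by simp
  then show ?thesis unfolding dist_power_def by (intro INF_cong) auto
qed

text \<open>
  The jet norms are definite. A function with vanishing distance is a limit of multiples of \<open>\<phi>\<close>, so
  it vanishes at \<open>z\<close> by continuity of the evaluation there; dividing by \<open>\<phi>\<close> lowers the order.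
\<close>

lemma dist_power_zero:
  assumes "f \<in> F" "dist_power m f = 0"
  shows "\<exists>g\<in>F. f = mult_power m g"
  using assms
proof (induction m arbitrary: f)
  case 0
  then show ?case by (auto simp: mult_power_0)
next
  case (Suc m)
  obtain C where C: "\<forall>f\<in>F. norm (f z) \<le> C * N f" using evaluation_bounded[OF z_in] by blast
  have small: "norm (f z) \<le> \<bar>C\<bar> * e" if pos: "e > 0" for e
  proof -
    obtain g where g: "g \<in> F" "N (f - mult_power (Suc m) g) < e"
      using dist_power_approx[OF pos, of f "Suc m"] Suc.prems(2) by auto
    let ?h = "f - mult_power (Suc m) g"
    have h: "?h \<in> F" using Suc.prems g by (intro diff_in mult_power_in)
    have "norm (f z) = norm (?h z)" by (simp add: mult_power_def \<phi>_z)
    also have "\<dots> \<le> C * N ?h" using C h by blast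
    also have "\<dots> \<le> \<bar>C\<bar> * N ?h" using norm_ge_zero[OF h] by (intro mult_right_mono) auto
    also have "\<dots> \<le> \<bar>C\<bar> * e" using g by (intro mult_left_mono) auto
    finally show ?thesis .
  qed
  have "norm (f z) \<le> 0"
  proof (rule field_le_epsilon)
    fix e :: real assume "e > 0"
    then have "norm (f z) \<le> \<bar>C\<bar> * (e / (\<bar>C\<bar> + 1))" by (intro small) (simp add: add_nonneg_pos)
    also have "\<dots> \<le> (\<bar>C\<bar> + 1) * (e / (\<bar>C\<bar> + 1))"
      using \<open>e > 0\<close> by (intro mult_right_mono) auto
    also have "\<dots> = e" by (simp add: add_nonneg_pos less_imp_neq[symmetric])
    finally show "norm (f z) \<le> 0 + e" by simp
  qed
  then have "f z = 0" by simp
  then obtain g where g: "g \<in> F" "f = mult_power 1 g"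
    using vanishing_iff_mult_power[OF Suc.prems(1), of 1]
      taylor_coeff_zero_order[OF analytic[OF Suc.prems(1)] z_in] by auto
  then have "dist_power m g = 0" using dist_power_mult Suc.prems by simp
  then obtain g' where "g' \<in> F" "g = mult_power m g'" using Suc.IH g by blast
  then show ?case using g mult_power_add[of 1 m g'] by (intro bexI[of _ g']) simp_all
qed

lemma strictly_singular_jet_proj_iff:
  assumes "k \<le> m"
  shows "strictly_singular (jet_space F z m) (jet_norm F N z m)
      (jet_space F z k) (jet_norm F N z k) (jet_proj k)
    \<longleftrightarrow> strictly_finer F (dist_power m) (dist_power k)"
proof -
  have eq: "seminorm_on F q \<longleftrightarrow> seminorm_on F (dist_power j)"
    if "\<And>f. f \<in> F \<Longrightarrow> q f = dist_power j f" for q j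
    using that complex_vector.subspace_add[OF subspace] complex_vector.subspace_scale[OF subspace]
    by (simp add: seminorm_on_def subspace)
  have q: "jet_norm F N z k (jet_proj k (jet m f)) = dist_power k f" if "f \<in> F" for f
    using that assms by (simp add: jet_proj_jet jet_norm_jet)
  have "bounded_operator_on (jet m ` F) (jet_norm F N z m)
      (jet_space F z k) (jet_norm F N z k) (jet_proj k)"
    unfolding bounded_operator_on_def
  proof (intro conjI ballI allI exI)
    show "jet_proj k ` jet m ` F \<subseteq> jet_space F z k"
      using assms by (auto simp: jet_proj_jet jet_space_eq)
    show "jet_proj k (x + y) = jet_proj k x + jet_proj k y" for x y :: "nat \<Rightarrow> 'w"
      by (auto simp: jet_proj_def)
    show "jet_proj k (a *\<^sub>C x) = a *\<^sub>C jet_proj k x" for a and x :: "nat \<Rightarrow> 'w"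
      by (auto simp: jet_proj_def scaleC_fun_def)
    show "jet_norm F N z k (jet_proj k x) \<le> 1 * jet_norm F N z m x" if "x \<in> jet m ` F" for x
      using that q jet_norm_jet dist_power_mono[OF assms] by auto
  qed
  then have "strictly_singular (jet m ` F) (jet_norm F N z m)
      (jet_space F z k) (jet_norm F N z k) (jet_proj k)
    \<longleftrightarrow> strictly_finer F (\<lambda>f. jet_norm F N z m (jet m f))
        (\<lambda>f. jet_norm F N z k (jet_proj k (jet m f)))"
  proof (intro strictly_singular_iff_strictly_finer linear_on_jet)
    show "seminorm_on F (\<lambda>f. jet_norm F N z m (jet m f))"
      "seminorm_on F (\<lambda>f. jet_norm F N z k (jet_proj k (jet m f)))"
      using eq[OF jet_norm_jet] eq[OF q] seminorm_on_dist_power by auto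
    show "jet m f = 0" if "f \<in> F" "jet_norm F N z m (jet m f) = 0" for f
      using that dist_power_zero jet_norm_jet jet_eq_zero_iff by auto
  qed
  also have "\<dots> \<longleftrightarrow> strictly_finer F (dist_power m) (dist_power k)"
    using q jet_norm_jet by (intro strictly_finer_cong subspace) auto
  finally show ?thesis by (simp add: jet_space_eq)
qed

text \<open>
  Induction with the three-space lemma for \<open>Y = \<phi> F\<close>. The seminorm \<open>dist_power 1\<close> measures the
  distance to \<open>Y\<close>, and it does not control \<open>dist_power (k + 2)\<close> on large subspaces because it
  does not even control \<open>dist_power 2\<close>. On \<open>Y\<close> the seminorms of orders \<open>k + 2\<close> and \<open>k + 1\<close>
  are those of orders \<open>k + 1\<close> and \<open>k\<close>, which the induction hypothesis covers.
\<close>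

lemma strictly_finer_dist_power_Suc:
  assumes base: "strictly_finer F (dist_power 2) (dist_power 1)" and "1 \<le> k"
  shows "strictly_finer F (dist_power (Suc k)) (dist_power k)"
  using \<open>1 \<le> k\<close>
proof (induction k rule: dec_induct)
  case base
  then show ?case using assms(1) by (simp add: numeral_2_eq_2)
next
  case (step k)
  note sn = seminorm_on_dist_power
  let ?Y = "mult_power 1 ` F"
  show ?case
  proof (rule strictly_finer_three_space[where s = "dist_power 1" and Y = ?Y, OF sn sn sn])
    show "dist_power (Suc k) f \<le> dist_power (Suc (Suc k)) f" if "f \<in> F" for f
      using that by (intro dist_power_mono) auto
    show "csubspace ?Y" "?Y \<subseteq> F"
      using csubspace_image_linear_on[OF linear_on_mult_power subspace] subspace mult_power_in by auto
    show "\<exists>y\<in>?Y. dist_power (Suc (Suc k)) (f - y) < dist_power 1 f + e" if "f \<in> F" "e > 0" for f e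
    proof -
      obtain g where g: "g \<in> F" "N (f - mult_power 1 g) < dist_power 1 f + e"
        using dist_power_approx[OF \<open>e > 0\<close>] by blast
      have "dist_power (Suc (Suc k)) (f - mult_power 1 g) \<le> N (f - mult_power 1 g)"
        using g that by (intro dist_power_le_norm diff_in mult_power_in)
      then show ?thesis using g by force
    qed
    show "strictly_finer F (dist_power (Suc (Suc k))) (dist_power 1)"
      by (rule strictly_finer_finer[OF base sn sn sn]) (auto intro: dist_power_mono)
    show "strictly_finer ?Y (dist_power (Suc (Suc k))) (dist_power (Suc k))"
    proof (rule strictly_finer_image[OF linear_on_mult_power[OF subspace]])
      show "strictly_finer F (\<lambda>f. dist_power (Suc (Suc k)) (mult_power 1 f))
          (\<lambda>f. dist_power (Suc k) (mult_power 1 f))"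
        by (rule iffD2[OF strictly_finer_cong[OF subspace, of _ "dist_power (Suc k)" _ "dist_power k"]
              step.IH]) (rule dist_power_mult, assumption)+
    qed
  qed
qed

end

section \<open>Strict singularity of all jet projections\<close>

theorem proposition3:
  fixes U :: "complex set"
    and F :: "(complex \<Rightarrow> 'w::complex_banach) set"
    and N :: "(complex \<Rightarrow> 'w) \<Rightarrow> real"
    and z :: complex
    and n k :: nat
  assumes "open U"
    and "\<exists>\<phi>. conformal_equivalence \<phi> U (ball 0 1)"
    and "admissible_space U F N"
    and "z \<in> U"
    and "strictly_singular (jet_space F z 2) (jet_norm F N z 2)
          (jet_space F z 1) (jet_norm F N z 1) (jet_proj 1)"
    and "1 \<le> k" and "k < n"
  shows "strictly_singular (jet_space F z n) (jet_norm F N z n)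
          (jet_space F z k) (jet_norm F N z k) (jet_proj k)"
proof -
  obtain \<phi> where "conformal_equivalence \<phi> U (ball 0 1)" "\<phi> z = 0"
    using assms(2,4) conformal_equivalence_centred by blast
  then interpret centred_admissible_space U F N \<phi> z
    using assms by (simp add: centred_admissible_space_def centred_admissible_space_axioms_def)
  have "strictly_finer F (dist_power 2) (dist_power 1)"
    using assms(5) strictly_singular_jet_proj_iff[of 1 2] by simp
  then have "strictly_finer F (dist_power (Suc k)) (dist_power k)"
    using \<open>1 \<le> k\<close> by (rule strictly_finer_dist_power_Suc)
  then have "strictly_finer F (dist_power n) (dist_power k)"
    using seminorm_on_dist_power \<open>k < n\<close>
    by (rule_tac strictly_finer_finer[where r = "dist_power (Suc k)"]) (auto intro: dist_power_mono)
  then show ?thesis using strictly_singular_jet_proj_iff[of k n] \<open>k < n\<close> by simp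
qed

end
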